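(* Let $(F,f_1,f_2,G,g_1,g_2)$ be a regular solution of $$F\Big(\frac{x+y}{2}\Big)+f_1(x)+f_2(y)=G(g_1(x)+g_2(y)),\qquad x,y\in I, \tag{E}$$ such that condition (B.2.2) (defined in the context) holds. Then there exist $A,B,C,D\in\mathbb{R}$ with $AD\neq0$, $\alpha,\beta,\beta_1,\beta_2\in\mathbb{R}$ with $\alpha\neq0$ and $\beta_1+\beta_2=\beta$, and $\lambda,\lambda_1,\lambda_2,\mu_1,\mu_2\in\mathbb{R}$ such that, with $\mu:=\mu_1+\mu_2$ and $\Lambda:=\lambda+\lambda_1+\lambda_2$, one of the following two alternatives holds (all formulas being for $k=1,2$, for all $x\in I$ and for all $u\in g_1(I)+g_2(I)$). First alternative: $F$ is of the form $$F(x)=2A\ln|2\alpha x+\beta|+2Bx+\lambda,\qquad x\in I,$$ and either (P1.1) $f_k(x)=-A\ln|(\alpha x+\beta_k)^2+1|-Bx+C\arctan(\alpha x+\beta_k)+\lambda_k$, $\ g_k(x)=D\arctan(\alpha x+\beta_k)+\mu_k$, $\ G(u)=2A\ln|\sin(\tfrac{u-\mu}{D})|+C\tfrac{u-\mu}{D}+\Lambda$, or (P1.2) $f_k(x)=-2A\ln|\alpha x+\beta_k|-Bx+C(\alpha x+\beta_k)^{-1}+\lambda_k$, $\ g_k(x)=D(\alpha x+\beta_k)^{-1}+\mu_k$, $\ G(u)=2A\ln|\tfrac{u-\mu}{D}|+C\tfrac{u-\mu}{D}+\Lambda$, or (P1.3) $f_k(x)=-A\ln|(\alpha x+\beta_k)^2-1|-Bx+C\ln\big|\tfrac{\alpha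 x+\beta_k-1}{\alpha x+\beta_k+1}\big|+\lambda_k$, $\ g_k(x)=D\ln\big|\tfrac{\alpha x+\beta_k-1}{\alpha x+\beta_k+1}\big|+\mu_k$, $\ G(u)=2A\ln|\sinh(\tfrac{u-\mu}{2D})|+C\tfrac{u-\mu}{D}+\Lambda$, or (P1.4) there exist $A_1,A_2\in\mathbb{R}$ with $\frac12(A_1+A_2)=A$ such that $f_k(x)=-A_k\ln|\alpha x+\beta_k|-Bx+\lambda_k$, $\ g_k(x)=(-1)^{k-1}D\ln|\alpha x+\beta_k|+\mu_k$, $\ G(u)=2A\ln|\exp(\tfrac{u-\mu}{D})+1|-A_1\tfrac{u-\mu}{D}+\Lambda$. Second alternative: either (P2.1) there exist $A_k,B_k,D_k\in\mathbb{R}$ $(k=1,2)$ with $D_1D_2(A+4A_k)=D_k^2A$ and $B+2B_k=2D_kC$ such that $F(x)=Ax^2+Bx+\lambda$, $\ f_k(x)=A_kx^2+B_kx+\lambda_k$, $\ g_k(x)=D_kx+\mu_k$, $\ G(u)=\tfrac{1}{4D_1D_2}A(u-\mu)^2+C(u-\mu)+\Lambda$, or (P2.2) $F(x)=A(2x+\beta)^2+2Bx+\lambda$, $\ f_k(x)=-A(x+\beta_k)^2-Bx+C\ln|x+\beta_k|+\lambda_k$, $\ g_k(x)=D\ln|x+\beta_k|+\mu_k$, $\ G(u)=2A\exp(\tfrac{u-\mu}{D})+C\tfrac{u-\mu}{D}+\Lambda$. Conversely, in each of the possibilities (P1.1), (P1.2), (P1.3), (P1.4) (with $F(x)=2A\ln|2\alpha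 x+\beta|+2Bx+\lambda$ for $x\in I$), (P2.1) and (P2.2), with constants as listed in this statement, we obtain a regular solution of (E).
   Context: $I\subseteq\mathbb{R}$ is a nonempty open interval; $F,f_1,f_2,g_1,g_2:I\to\mathbb{R}$ and $G:g_1(I)+g_2(I)\to\mathbb{R}$, where $X+Y=\{x+y\mid x\in X,\ y\in Y\}$. The tuple $(F,f_1,f_2,G,g_1,g_2)$ is called regular if all six functions are continuously differentiable on their domains and $0\notin g_1'(I)\cup g_2'(I)$. For a regular solution put, on $I$ and for $k=1,2$, $$\varphi:=\tfrac12F',\qquad \psi_k:=\frac1{g_1'}+(-1)^k\frac1{g_2'},\qquad \Psi_k:=-\frac{f_1'}{g_1'}+(-1)^{k-1}\frac{f_2'}{g_2'}.$$ A function on $I$ is nowhere constant if it is neither constant on $I$ nor constant on some subinterval of $I$ of positive length different from $I$. Condition (4.2): there exist $a,b,c,d,\gamma\in\mathbb{R}$ with $ad\neq bc$ such that, with $\kappa:=\sqrt{|\gamma|}$, for all $x\in I$ $$\varphi(x)=\frac{cS(x)+dC_0(x)}{aS(x)+bC_0(x)},\qquad \psi_1(x)=aS(x)+bC_0(x)\neq0,$$ where $(S(x),C_0(x))$ is $(\sin\kappa x,\cos\kappa x)$ if $\gamma<0$, $(x,1)$ if $\gamma=0$, and $(\sinh\kappa x,\cosh\kappa x)$ if $\gamma>0$. Condition (5.2): there exist $a^*,b^*,c^*,d^*,\gamma^*\in\mathbb{R}$ with $a^*d^*\neq b^*c^*$ and $\lambda^*,\mu^*\in\mathbb{R}$ such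 that, with $\kappa^*:=\sqrt{|\gamma^*|}$, for all $x\in I$ $$\varphi(x)=\frac{c^*S(x)+d^*C_0(x)}{a^*S(x)+b^*C_0(x)},\quad \psi_2(x)=a^*P(x)+b^*Q(x)+\lambda^*,\quad \Psi_2(x)=c^*P(x)+d^*Q(x)+\mu^*,$$ where $(S,C_0)$ is as in (4.2) with $\gamma^*,\kappa^*$ in place of $\gamma,\kappa$, and $(P(x),Q(x))$ is $(-\cos\kappa^*x,\sin\kappa^*x)$ if $\gamma^*<0$, $(\frac12x^2,x)$ if $\gamma^*=0$, and $(\cosh\kappa^*x,\sinh\kappa^*x)$ if $\gamma^*>0$. Condition (B.2.2): $\varphi$ is nowhere constant on $I$, at least one of (4.2) and (5.2) holds, and $\varphi$ is a linear fraction on $I$, that is, $\varphi(x)=\frac{cx+d}{ax+b}$ for all $x\in I$ with some $a,b,c,d\in\mathbb{R}$, $ad\neq bc$.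
   Formalization: The printed G in (P1.3), (P1.4), (P2.2) is right only if the product over k=1,2 of (αx+β_k)²−1, αx+β_k, x+β_k respectively is positive on I; if it is negative, sinh becomes cosh, exp(·)+1 becomes exp(·)−1, and 2A exp becomes −2A exp. *)

theory Defs
  imports "HOL-Analysis.Analysis"
begin

text \<open>Functions on a set are total functions of which only the values on that set are used;
  pairs \<open>f\<^sub>1, f\<^sub>2\<close> are families \<open>f k\<close> with \<open>k \<in> {1, 2}\<close>. All domains below are open
  (for \<open>G\<close>: because \<open>g\<^sub>1, g\<^sub>2\<close> are strictly monotone), so derivatives at a point of the domain
  do not depend on the values outside. \<open>X + Y\<close> on sets is the Minkowski sum.\<close>

definition regular ::
  "real set \<Rightarrow> (real \<Rightarrow> real) \<Rightarrow> (nat \<Rightarrow> real \<Rightarrow> real) \<Rightarrow> (real \<Rightarrow> real) \<Rightarrow> (nat \<Rightarrow> real \<Rightarrow> real) \<Rightarrow> bool"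
where
  "regular I F f G g \<longleftrightarrow>
     F C1_differentiable_on I \<and>
     (\<forall>k\<in>{1,2}. f k C1_differentiable_on I \<and> g k C1_differentiable_on I) \<and>
     G C1_differentiable_on (g 1 ` I + g 2 ` I) \<and>
     0 \<notin> deriv (g 1) ` I \<union> deriv (g 2) ` I"

definition solves ::
  "real set \<Rightarrow> (real \<Rightarrow> real) \<Rightarrow> (nat \<Rightarrow> real \<Rightarrow> real) \<Rightarrow> (real \<Rightarrow> real) \<Rightarrow> (nat \<Rightarrow> real \<Rightarrow> real) \<Rightarrow> bool"
where
  "solves I F f G g \<longleftrightarrow>
     (\<forall>x\<in>I. \<forall>y\<in>I. F ((x + y) / 2) + f 1 x + f 2 y = G (g 1 x + g 2 y))"

definition regular_solution ::
  "real set \<Rightarrow> (real \<Rightarrow> real) \<Rightarrow> (nat \<Rightarrow> real \<Rightarrow> real) \<Rightarrow> (real \<Rightarrow> real) \<Rightarrow> (nat \<Rightarrow> real \<Rightarrow> real) \<Rightarrow> bool"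
where
  "regular_solution I F f G g \<longleftrightarrow> regular I F f G g \<and> solves I F f G g"

definition phi :: "(real \<Rightarrow> real) \<Rightarrow> real \<Rightarrow> real" where
  "phi F x = deriv F x / 2"

definition psi :: "(nat \<Rightarrow> real \<Rightarrow> real) \<Rightarrow> nat \<Rightarrow> real \<Rightarrow> real" where
  "psi g k x = 1 / deriv (g 1) x + (-1) ^ k * (1 / deriv (g 2) x)"

definition Psi :: "(nat \<Rightarrow> real \<Rightarrow> real) \<Rightarrow> (nat \<Rightarrow> real \<Rightarrow> real) \<Rightarrow> nat \<Rightarrow> real \<Rightarrow> real" where
  "Psi f g k x =
     - (deriv (f 1) x / deriv (g 1) x) + (-1) ^ (k - 1) * (deriv (f 2) x / deriv (g 2) x)"

definition nowhere_constant_on :: "real set \<Rightarrow> (real \<Rightarrow> real) \<Rightarrow> bool" where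
  "nowhere_constant_on I h \<longleftrightarrow>
     \<not> h constant_on I \<and>
     \<not> (\<exists>J. is_interval J \<and> J \<subseteq> I \<and> J \<noteq> I \<and> (\<exists>s\<in>J. \<exists>t\<in>J. s < t) \<and> h constant_on J)"

definition S_fun :: "real \<Rightarrow> real \<Rightarrow> real" where
  "S_fun \<gamma> x =
     (if \<gamma> < 0 then sin (sqrt \<bar>\<gamma>\<bar> * x) else if \<gamma> = 0 then x else sinh (sqrt \<bar>\<gamma>\<bar> * x))"

definition C_fun :: "real \<Rightarrow> real \<Rightarrow> real" where
  "C_fun \<gamma> x =
     (if \<gamma> < 0 then cos (sqrt \<bar>\<gamma>\<bar> * x) else if \<gamma> = 0 then 1 else cosh (sqrt \<bar>\<gamma>\<bar> * x))"

definition P_fun :: "real \<Rightarrow> real \<Rightarrow> real" where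
  "P_fun \<gamma> x =
     (if \<gamma> < 0 then - cos (sqrt \<bar>\<gamma>\<bar> * x) else if \<gamma> = 0 then x\<^sup>2 / 2 else cosh (sqrt \<bar>\<gamma>\<bar> * x))"

definition Q_fun :: "real \<Rightarrow> real \<Rightarrow> real" where
  "Q_fun \<gamma> x =
     (if \<gamma> < 0 then sin (sqrt \<bar>\<gamma>\<bar> * x) else if \<gamma> = 0 then x else sinh (sqrt \<bar>\<gamma>\<bar> * x))"

definition cond_4_2 :: "real set \<Rightarrow> (real \<Rightarrow> real) \<Rightarrow> (nat \<Rightarrow> real \<Rightarrow> real) \<Rightarrow> bool" where
  "cond_4_2 I F g \<longleftrightarrow>
     (\<exists>a b c d \<gamma>. a * d \<noteq> b * c \<and>
        (\<forall>x\<in>I. phi F x = (c * S_fun \<gamma> x + d * C_fun \<gamma> x) / (a * S_fun \<gamma> x + b * C_fun \<gamma> x) \<and>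
                psi g 1 x = a * S_fun \<gamma> x + b * C_fun \<gamma> x \<and> psi g 1 x \<noteq> 0))"

text \<open>Since \<open>t / 0 = 0\<close>, that a quotient is defined has to be stated separately, here
  and below.\<close>

definition cond_5_2 ::
  "real set \<Rightarrow> (real \<Rightarrow> real) \<Rightarrow> (nat \<Rightarrow> real \<Rightarrow> real) \<Rightarrow> (nat \<Rightarrow> real \<Rightarrow> real) \<Rightarrow> bool"
where
  "cond_5_2 I F f g \<longleftrightarrow>
     (\<exists>a b c d \<gamma> l m. a * d \<noteq> b * c \<and>
        (\<forall>x\<in>I. a * S_fun \<gamma> x + b * C_fun \<gamma> x \<noteq> 0 \<and>
                phi F x = (c * S_fun \<gamma> x + d * C_fun \<gamma> x) / (a * S_fun \<gamma> x + b * C_fun \<gamma> x) \<and>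
                psi g 2 x = a * P_fun \<gamma> x + b * Q_fun \<gamma> x + l \<and>
                Psi f g 2 x = c * P_fun \<gamma> x + d * Q_fun \<gamma> x + m))"

definition linear_fraction_on :: "real set \<Rightarrow> (real \<Rightarrow> real) \<Rightarrow> bool" where
  "linear_fraction_on I h \<longleftrightarrow>
     (\<exists>a b c d. a * d \<noteq> b * c \<and>
        (\<forall>x\<in>I. a * x + b \<noteq> 0 \<and> h x = (c * x + d) / (a * x + b)))"

definition cond_B_2_2 ::
  "real set \<Rightarrow> (real \<Rightarrow> real) \<Rightarrow> (nat \<Rightarrow> real \<Rightarrow> real) \<Rightarrow> (nat \<Rightarrow> real \<Rightarrow> real) \<Rightarrow> bool"
where
  "cond_B_2_2 I F f g \<longleftrightarrow>
     nowhere_constant_on I (phi F) \<and> (cond_4_2 I F g \<or> cond_5_2 I F f g) \<and>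
     linear_fraction_on I (phi F)"

text \<open>
  The solution families. The constants \<open>\<beta>\<^sub>k, \<lambda>\<^sub>k, \<mu>\<^sub>k\<close> are \<open>b k, l k, m k\<close>, and \<open>\<beta>, \<lambda>\<close> are \<open>\<beta>, l0\<close>.
  Each family requires the expressions for \<open>F, f\<^sub>k, g\<^sub>k\<close> to be defined on \<open>I\<close> (nonzero arguments
  of \<open>ln \<bar>\<cdot>\<bar>\<close> and nonzero denominators). The arguments of \<open>ln \<bar>\<cdot>\<bar>\<close> in \<open>G\<close> are then nonzero
  on \<open>g\<^sub>1(I) + g\<^sub>2(I)\<close>, because \<open>2\<alpha>x + \<beta>\<close> has no zero on \<open>I\<close>.

  Signs: \<open>g\<^sub>k\<close> only sees absolute values, so in three families \<open>G\<close> depends on whether two factors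
  have equal or opposite signs on \<open>I\<close>; this is recorded by \<open>\<epsilon>\<close>. Opposite signs do occur, e.g.
  on \<open>I = (0, 1)\<close>
  \<^item> \<open>F(x) = (2x - 3)\<^sup>2\<close>, \<open>f\<^sub>1(x) = -x\<^sup>2\<close>, \<open>f\<^sub>2(x) = -(x - 3)\<^sup>2\<close>, \<open>g\<^sub>1(x) = ln \<bar>x\<bar>\<close>,
    \<open>g\<^sub>2(x) = ln \<bar>x - 3\<bar>\<close>, for which \<open>G(u) = -2 exp u\<close> rather than \<open>2 exp u\<close>;
  \<^item> \<open>F(x) = 2 ln \<bar>2x - 3\<bar>\<close>, \<open>f\<^sub>1(x) = - ln \<bar>x\<bar>\<close>, \<open>f\<^sub>2(x) = - ln \<bar>x - 3\<bar>\<close>, \<open>g\<^sub>1(x) = ln \<bar>x\<bar>\<close>,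
    \<open>g\<^sub>2(x) = - ln \<bar>x - 3\<bar>\<close>, for which \<open>G(u) = 2 ln \<bar>exp u - 1\<bar> - u\<close> rather than
    \<open>2 ln \<bar>exp u + 1\<bar> - u\<close>.

  For \<open>\<epsilon> = 1\<close> the formulas are the ones customarily listed, with \<open>sinh\<close>, \<open>exp + 1\<close> and \<open>2A exp\<close>.
\<close>

definition F_log ::
  "real set \<Rightarrow> (real \<Rightarrow> real) \<Rightarrow> real \<Rightarrow> real \<Rightarrow> real \<Rightarrow> real \<Rightarrow> real \<Rightarrow> bool"
where
  "F_log I F A B \<alpha> \<beta> l0 \<longleftrightarrow>
     (\<forall>x\<in>I. 2 * \<alpha> * x + \<beta> \<noteq> 0 \<and> F x = 2 * A * ln \<bar>2 * \<alpha> * x + \<beta>\<bar> + 2 * B * x + l0)"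

definition P1_1 ::
  "real set \<Rightarrow> (nat \<Rightarrow> real \<Rightarrow> real) \<Rightarrow> (real \<Rightarrow> real) \<Rightarrow> (nat \<Rightarrow> real \<Rightarrow> real) \<Rightarrow>
   real \<Rightarrow> real \<Rightarrow> real \<Rightarrow> real \<Rightarrow> real \<Rightarrow> (nat \<Rightarrow> real) \<Rightarrow> real \<Rightarrow> (nat \<Rightarrow> real) \<Rightarrow> (nat \<Rightarrow> real) \<Rightarrow> bool"
where
  "P1_1 I f G g A B C D \<alpha> b l0 l m \<longleftrightarrow>
     (let \<mu> = m 1 + m 2; \<Lambda> = l0 + l 1 + l 2 in
      (\<forall>k\<in>{1,2}. \<forall>x\<in>I.
         f k x = - A * ln \<bar>(\<alpha> * x + b k)\<^sup>2 + 1\<bar> - B * x + C * arctan (\<alpha> * x + b k) + l k \<and>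
         g k x = D * arctan (\<alpha> * x + b k) + m k) \<and>
      (\<forall>u \<in> g 1 ` I + g 2 ` I.
         G u = 2 * A * ln \<bar>sin ((u - \<mu>) / D)\<bar> + C * ((u - \<mu>) / D) + \<Lambda>))"

definition P1_2 ::
  "real set \<Rightarrow> (nat \<Rightarrow> real \<Rightarrow> real) \<Rightarrow> (real \<Rightarrow> real) \<Rightarrow> (nat \<Rightarrow> real \<Rightarrow> real) \<Rightarrow>
   real \<Rightarrow> real \<Rightarrow> real \<Rightarrow> real \<Rightarrow> real \<Rightarrow> (nat \<Rightarrow> real) \<Rightarrow> real \<Rightarrow> (nat \<Rightarrow> real) \<Rightarrow> (nat \<Rightarrow> real) \<Rightarrow> bool"
where
  "P1_2 I f G g A B C D \<alpha> b l0 l m \<longleftrightarrow>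
     (let \<mu> = m 1 + m 2; \<Lambda> = l0 + l 1 + l 2 in
      (\<forall>k\<in>{1,2}. \<forall>x\<in>I. \<alpha> * x + b k \<noteq> 0 \<and>
         f k x = - 2 * A * ln \<bar>\<alpha> * x + b k\<bar> - B * x + C * inverse (\<alpha> * x + b k) + l k \<and>
         g k x = D * inverse (\<alpha> * x + b k) + m k) \<and>
      (\<forall>u \<in> g 1 ` I + g 2 ` I.
         G u = 2 * A * ln \<bar>(u - \<mu>) / D\<bar> + C * ((u - \<mu>) / D) + \<Lambda>))"

definition P1_3 ::
  "real set \<Rightarrow> (nat \<Rightarrow> real \<Rightarrow> real) \<Rightarrow> (real \<Rightarrow> real) \<Rightarrow> (nat \<Rightarrow> real \<Rightarrow> real) \<Rightarrow>
   real \<Rightarrow> real \<Rightarrow> real \<Rightarrow> real \<Rightarrow> real \<Rightarrow> (nat \<Rightarrow> real) \<Rightarrow> real \<Rightarrow> (nat \<Rightarrow> real) \<Rightarrow> (nat \<Rightarrow> real) \<Rightarrow> bool"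
where
  "P1_3 I f G g A B C D \<alpha> b l0 l m \<longleftrightarrow>
     (let \<mu> = m 1 + m 2; \<Lambda> = l0 + l 1 + l 2 in
      (\<forall>k\<in>{1,2}. \<forall>x\<in>I. (\<alpha> * x + b k)\<^sup>2 - 1 \<noteq> 0 \<and>
         f k x = - A * ln \<bar>(\<alpha> * x + b k)\<^sup>2 - 1\<bar> - B * x
                 + C * ln \<bar>(\<alpha> * x + b k - 1) / (\<alpha> * x + b k + 1)\<bar> + l k \<and>
         g k x = D * ln \<bar>(\<alpha> * x + b k - 1) / (\<alpha> * x + b k + 1)\<bar> + m k) \<and>
      (\<exists>\<epsilon>\<in>{1, -1}. (\<forall>x\<in>I. sgn (((\<alpha> * x + b 1)\<^sup>2 - 1) * ((\<alpha> * x + b 2)\<^sup>2 - 1)) = \<epsilon>) \<and>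
         (\<forall>u \<in> g 1 ` I + g 2 ` I.
            G u = 2 * A * ln \<bar>(if \<epsilon> = 1 then sinh else cosh) ((u - \<mu>) / (2 * D))\<bar>
                  + C * ((u - \<mu>) / D) + \<Lambda>)))"

definition P1_4 ::
  "real set \<Rightarrow> (nat \<Rightarrow> real \<Rightarrow> real) \<Rightarrow> (real \<Rightarrow> real) \<Rightarrow> (nat \<Rightarrow> real \<Rightarrow> real) \<Rightarrow>
   real \<Rightarrow> real \<Rightarrow> real \<Rightarrow> real \<Rightarrow> (nat \<Rightarrow> real) \<Rightarrow> real \<Rightarrow> (nat \<Rightarrow> real) \<Rightarrow> (nat \<Rightarrow> real) \<Rightarrow> bool"
where
  "P1_4 I f G g A B D \<alpha> b l0 l m \<longleftrightarrow>
     (let \<mu> = m 1 + m 2; \<Lambda> = l0 + l 1 + l 2 in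
      \<exists>A' :: nat \<Rightarrow> real. (A' 1 + A' 2) / 2 = A \<and>
      (\<forall>k\<in>{1,2}. \<forall>x\<in>I. \<alpha> * x + b k \<noteq> 0 \<and>
         f k x = - A' k * ln \<bar>\<alpha> * x + b k\<bar> - B * x + l k \<and>
         g k x = (-1) ^ (k - 1) * D * ln \<bar>\<alpha> * x + b k\<bar> + m k) \<and>
      (\<exists>\<epsilon>\<in>{1, -1}. (\<forall>x\<in>I. sgn ((\<alpha> * x + b 1) * (\<alpha> * x + b 2)) = \<epsilon>) \<and>
         (\<forall>u \<in> g 1 ` I + g 2 ` I.
            G u = 2 * A * ln \<bar>exp ((u - \<mu>) / D) + \<epsilon>\<bar> - A' 1 * ((u - \<mu>) / D) + \<Lambda>)))"

definition P2_1 ::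
  "real set \<Rightarrow> (real \<Rightarrow> real) \<Rightarrow> (nat \<Rightarrow> real \<Rightarrow> real) \<Rightarrow> (real \<Rightarrow> real) \<Rightarrow> (nat \<Rightarrow> real \<Rightarrow> real) \<Rightarrow>
   real \<Rightarrow> real \<Rightarrow> real \<Rightarrow> real \<Rightarrow> (nat \<Rightarrow> real) \<Rightarrow> (nat \<Rightarrow> real) \<Rightarrow> bool"
where
  "P2_1 I F f G g A B C l0 l m \<longleftrightarrow>
     (let \<mu> = m 1 + m 2; \<Lambda> = l0 + l 1 + l 2 in
      \<exists>(A' :: nat \<Rightarrow> real) (B' :: nat \<Rightarrow> real) (D' :: nat \<Rightarrow> real).
      D' 1 * D' 2 \<noteq> 0 \<and>
      (\<forall>k\<in>{1,2}. D' 1 * D' 2 * (A + 4 * A' k) = (D' k)\<^sup>2 * A \<and> B + 2 * B' k = 2 * D' k * C) \<and>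
      (\<forall>x\<in>I. F x = A * x\<^sup>2 + B * x + l0) \<and>
      (\<forall>k\<in>{1,2}. \<forall>x\<in>I.
         f k x = A' k * x\<^sup>2 + B' k * x + l k \<and>
         g k x = D' k * x + m k) \<and>
      (\<forall>u \<in> g 1 ` I + g 2 ` I.
         G u = 1 / (4 * D' 1 * D' 2) * A * (u - \<mu>)\<^sup>2 + C * (u - \<mu>) + \<Lambda>))"

definition P2_2 ::
  "real set \<Rightarrow> (real \<Rightarrow> real) \<Rightarrow> (nat \<Rightarrow> real \<Rightarrow> real) \<Rightarrow> (real \<Rightarrow> real) \<Rightarrow> (nat \<Rightarrow> real \<Rightarrow> real) \<Rightarrow>
   real \<Rightarrow> real \<Rightarrow> real \<Rightarrow> real \<Rightarrow> real \<Rightarrow> (nat \<Rightarrow> real) \<Rightarrow> real \<Rightarrow> (nat \<Rightarrow> real) \<Rightarrow> (nat \<Rightarrow> real) \<Rightarrow> bool"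
where
  "P2_2 I F f G g A B C D \<beta> b l0 l m \<longleftrightarrow>
     (let \<mu> = m 1 + m 2; \<Lambda> = l0 + l 1 + l 2 in
      (\<forall>x\<in>I. F x = A * (2 * x + \<beta>)\<^sup>2 + 2 * B * x + l0) \<and>
      (\<forall>k\<in>{1,2}. \<forall>x\<in>I. x + b k \<noteq> 0 \<and>
         f k x = - A * (x + b k)\<^sup>2 - B * x + C * ln \<bar>x + b k\<bar> + l k \<and>
         g k x = D * ln \<bar>x + b k\<bar> + m k) \<and>
      (\<exists>\<epsilon>\<in>{1, -1}. (\<forall>x\<in>I. sgn ((x + b 1) * (x + b 2)) = \<epsilon>) \<and>
         (\<forall>u \<in> g 1 ` I + g 2 ` I.
            G u = 2 * A * \<epsilon> * exp ((u - \<mu>) / D) + C * ((u - \<mu>) / D) + \<Lambda>)))"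

definition admissible_constants ::
  "real \<Rightarrow> real \<Rightarrow> real \<Rightarrow> real \<Rightarrow> (nat \<Rightarrow> real) \<Rightarrow> bool"
where
  "admissible_constants A D \<alpha> \<beta> b \<longleftrightarrow> A * D \<noteq> 0 \<and> \<alpha> \<noteq> 0 \<and> b 1 + b 2 = \<beta>"

end

theory Submission
  imports Defs
begin

text \<open>
  \<^bold>\<open>Converse.\<close> In each family, \<open>F((x + y)/2) + f\<^sub>1(x) + f\<^sub>2(y)\<close> is a function of
  \<open>g\<^sub>1(x) + g\<^sub>2(y)\<close> by an addition theorem: with \<open>z = \<alpha>x + \<beta>\<^sub>1\<close> and \<open>w = \<alpha>y + \<beta>\<^sub>2\<close>, the
  argument of the logarithm in \<open>F\<close> is \<open>z + w\<close>, which up to factors depending on \<open>z\<close> alone and on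
  \<open>w\<close> alone is \<open>sin(arctan z + arctan w)\<close>, \<open>1/z + 1/w\<close>, and so on. This function must be \<open>G\<close>
  (\<open>solves_iff\<close>), so within each family the equation is equivalent to the formula for \<open>G\<close>. Smoothness
  is a direct calculation (\<open>regularI\<close>).

  \<^bold>\<open>Classification.\<close> Let \<open>p = 1/g\<^sub>1'\<close>, \<open>q = 1/g\<^sub>2'\<close>, \<open>r = -f\<^sub>1'/g\<^sub>1'\<close> and \<open>s = f\<^sub>2'/g\<^sub>2'\<close>.
  Differentiating the equation in both variables and eliminating \<open>G'\<close> gives
  \<open>\<phi>((x + y)/2) (p(x) - q(y)) = r(x) + s(y)\<close> (\<open>regular_solution_derivative_equation\<close>).

  If the linear fraction \<open>\<phi>\<close> has a pole, \<open>\<phi>(x) = B + A/(x + \<beta>)\<close>, then clearing the denominator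
  gives an equation in which a mixed second difference makes everything polynomial: with
  \<open>X = x + \<beta>\<close> one gets \<open>p = \<kappa>X\<^sup>2 + EX + h\<close>, \<open>q = \<kappa>X\<^sup>2 - EX + h\<close>, and
  \<open>f\<^sub>k' = -B - A p\<^sub>k'/p\<^sub>k + N g\<^sub>k'\<close> with \<open>p\<^sub>1 = p\<close>, \<open>p\<^sub>2 = q\<close> (\<open>pole_coefficients\<close>).
  The case \<open>\<kappa> = E = 0\<close> is excluded by \<open>equal_constant_slopes_contradiction\<close>. Otherwise the
  integration of \<open>g\<^sub>k' = 1/p\<^sub>k\<close> leads, according to the discriminant and to whether \<open>\<kappa> = 0\<close>, to the
  four logarithmic families (\<open>log_solution_cases\<close>). If \<open>\<phi>\<close> is affine, the same argument shows that
  \<open>p\<close> and \<open>q\<close> are affine with the same slope, which leads to the two families with quadratic \<open>F\<close>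
  (\<open>quadratic_solution_cases\<close>). The formula for \<open>G\<close> then follows from the equation.
\<close>

section \<open>Calculus on open intervals\<close>

lemma has_real_derivative_ln_abs [derivative_intros]:
  fixes h :: "real \<Rightarrow> real"
  assumes "(h has_real_derivative d) (at x)" and "h x \<noteq> 0"
  shows "((\<lambda>x. ln \<bar>h x\<bar>) has_real_derivative d / h x) (at x)"
proof -
  have "((\<lambda>y. ln \<bar>y\<bar>) has_real_derivative 1 / h x) (at (h x))"
  proof (cases "h x > 0")
    case True
    have "(ln has_real_derivative 1 / h x) (at (h x))"
      using True by (rule DERIV_ln_divide)
    then show ?thesis
      by (rule has_field_derivative_transform_within_open[where S = "{0<..}"]) (use True in auto)
  next
    case False
    with assms(2) have neg: "h x < 0" by simp
    have "((\<lambda>y. ln (- y)) has_real_derivative 1 / h x) (at (h x))"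
      using neg by (auto intro!: derivative_eq_intros)
    then show ?thesis
      by (rule has_field_derivative_transform_within_open[where S = "{..<0}"]) (use neg in auto)
  qed
  from DERIV_chain2[OF this assms(1)] show ?thesis by simp
qed

lemma C1_differentiable_onI:
  fixes h hh :: "real \<Rightarrow> real"
  assumes "open S" and "\<And>x. x \<in> S \<Longrightarrow> h x = hh x"
    and "\<And>x. x \<in> S \<Longrightarrow> (hh has_real_derivative h' x) (at x)"
    and "continuous_on S h'"
  shows "h C1_differentiable_on S"
    and "\<And>x. x \<in> S \<Longrightarrow> (h has_real_derivative h' x) (at x)"
proof -
  show *: "(h has_real_derivative h' x) (at x)" if "x \<in> S" for x
    using has_field_derivative_transform_within_open[OF assms(3)[OF that] assms(1) that]
      assms(2) by metis
  then show "h C1_differentiable_on S"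
    unfolding C1_differentiable_on_def
    using assms(4) by (auto simp: has_real_derivative_iff_has_vector_derivative)
qed

lemma C1_differentiable_on_DERIV:
  fixes h :: "real \<Rightarrow> real"
  assumes "h C1_differentiable_on S" and "x \<in> S"
  shows "(h has_real_derivative deriv h x) (at x)"
  using assms unfolding C1_differentiable_on_def
  by (metis DERIV_imp_deriv has_real_derivative_iff_has_vector_derivative)

lemma eq_antiderivative:
  fixes h H :: "real \<Rightarrow> real"
  assumes "is_interval I"
    and "\<And>x. x \<in> I \<Longrightarrow> (h has_real_derivative h' x) (at x)"
    and "\<And>x. x \<in> I \<Longrightarrow> (H has_real_derivative h' x) (at x)"
  obtains c where "\<And>x. x \<in> I \<Longrightarrow> h x = H x + c"
proof -
  have "((\<lambda>x. h x - H x) has_real_derivative 0) (at x within I)" if "x \<in> I" for x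
    using DERIV_diff[OF assms(2)[OF that] assms(3)[OF that]] has_field_derivative_at_within by simp
  from has_field_derivative_zero_constant[OF is_interval_convex[OF assms(1)] this]
  obtain c where "\<forall>x\<in>I. h x - H x = c" by auto
  then show ?thesis by (intro that[of c]) (auto simp: algebra_simps)
qed

lemma sgn_constant_on_interval:
  fixes h :: "real \<Rightarrow> real"
  assumes "is_interval I" and "continuous_on I h" and "\<And>x. x \<in> I \<Longrightarrow> h x \<noteq> 0"
  obtains \<epsilon> where "\<epsilon> \<in> {1, - 1}" and "\<And>x. x \<in> I \<Longrightarrow> sgn (h x) = \<epsilon>"
proof -
  have iv: "is_interval (h ` I)"
    using assms(1,2) connected_continuous_image is_interval_connected_1 by blast
  have no: "\<not> (x \<in> I \<and> y \<in> I \<and> h x < 0 \<and> 0 < h y)" for x y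
  proof
    assume "x \<in> I \<and> y \<in> I \<and> h x < 0 \<and> 0 < h y"
    then have "0 \<in> h ` I"
      using iv unfolding is_interval_1 by (meson imageI less_imp_le)
    then show False using assms(3) by force
  qed
  show ?thesis
  proof (cases "\<exists>x\<in>I. h x < 0")
    case True
    then have "sgn (h x) = - 1" if "x \<in> I" for x
      using no assms(3)[OF that] that by (metis linorder_neqE sgn_neg)
    then show ?thesis by (intro that[of "- 1"]) auto
  next
    case False
    then have "sgn (h x) = 1" if "x \<in> I" for x
      using assms(3)[OF that] that by (metis linorder_neqE sgn_pos)
    then show ?thesis by (intro that[of 1]) auto
  qed
qed

text \<open>The sign \<open>\<epsilon>\<close> in three of the families is prescribed for \<open>h1 x * h2 x\<close> only, but is needed at
  two different points; since neither factor changes its sign on an interval, this makes no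
  difference.\<close>

lemma sgn_product_constant_on_interval:
  fixes h1 h2 :: "real \<Rightarrow> real"
  assumes "I \<noteq> {}" and "is_interval I"
    and "continuous_on I h1" and "continuous_on I h2"
    and "\<And>x. x \<in> I \<Longrightarrow> h1 x \<noteq> 0" and "\<And>x. x \<in> I \<Longrightarrow> h2 x \<noteq> 0"
  obtains \<epsilon> where "\<epsilon> \<in> {1, - 1}"
    and "\<And>x y. x \<in> I \<Longrightarrow> y \<in> I \<Longrightarrow> sgn (h1 x * h2 y) = \<epsilon>"
    and "\<And>\<epsilon>'. \<forall>x\<in>I. sgn (h1 x * h2 x) = \<epsilon>' \<Longrightarrow> \<epsilon>' = \<epsilon>"
proof -
  obtain \<epsilon>1 where 1: "\<epsilon>1 \<in> {1, -1}" "\<And>x. x \<in> I \<Longrightarrow> sgn (h1 x) = \<epsilon>1"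
    using sgn_constant_on_interval[OF assms(2,3,5)] by blast
  obtain \<epsilon>2 where 2: "\<epsilon>2 \<in> {1, -1}" "\<And>x. x \<in> I \<Longrightarrow> sgn (h2 x) = \<epsilon>2"
    using sgn_constant_on_interval[OF assms(2,4,6)] by blast
  show ?thesis
  proof (rule that[of "\<epsilon>1 * \<epsilon>2"])
    show "\<epsilon>1 * \<epsilon>2 \<in> {1, - 1}" using 1(1) 2(1) by auto
    show *: "sgn (h1 x * h2 y) = \<epsilon>1 * \<epsilon>2" if "x \<in> I" "y \<in> I" for x y
      using 1(2)[OF that(1)] 2(2)[OF that(2)] by (simp add: sgn_mult)
    show "\<epsilon>' = \<epsilon>1 * \<epsilon>2" if "\<forall>x\<in>I. sgn (h1 x * h2 x) = \<epsilon>'" for \<epsilon>'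
      using that * assms(1) by (metis ex_in_conv)
  qed
qed

lemma open_image_nonzero_deriv:
  fixes h :: "real \<Rightarrow> real"
  assumes "open I" and "is_interval I"
    and d: "\<And>x. x \<in> I \<Longrightarrow> (h has_real_derivative h' x) (at x)"
    and nz: "\<And>x. x \<in> I \<Longrightarrow> h' x \<noteq> 0"
  shows "open (h ` I)"
proof (rule invariance_of_domain)
  have cont: "isCont h x" if "x \<in> I" for x
    using d[OF that] by (rule DERIV_isCont)
  then show "continuous_on I h"
    by (simp add: continuous_at_imp_continuous_on)
  have False if "x \<in> I" "y \<in> I" "x < y" "h x = h y" for x y
  proof -
    have sub: "z \<in> I" if "x \<le> z" "z \<le> y" for z
      using assms(2) \<open>x \<in> I\<close> \<open>y \<in> I\<close> that unfolding is_interval_1 by blast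
    have "continuous_on {x..y} h"
      using cont sub by (simp add: continuous_at_imp_continuous_on)
    moreover have "h differentiable (at z)" if "x < z" "z < y" for z
      using d[OF sub[of z]] that unfolding real_differentiable_def by auto
    ultimately obtain z where z: "x < z" "z < y" "DERIV h z :> 0"
      using Rolle[OF \<open>x < y\<close> \<open>h x = h y\<close>] by blast
    then show False using d[of z] nz[of z] sub[of z] DERIV_unique by fastforce
  qed
  then show "inj_on h I"
    unfolding inj_on_def by (metis linorder_neqE)
qed (use assms in auto)

lemma open_set_plus:
  fixes S T :: "real set"
  assumes "open S"
  shows "open (S + T)"
proof -
  have "S + T = (\<Union>x\<in>S. \<Union>y\<in>T. {x + y})"
    by (auto simp: set_plus_def)
  then show ?thesis using open_sums[of S T] assms by simp
qed

text \<open>The functions with doubled names are closed formulas for \<open>F, f, g, G\<close>, which agree with them only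
  on the respective domains. The domain of \<open>G\<close> is open because \<open>g\<^sub>1\<close> is injective and continuous, so
  that there, too, the derivative is that of the formula.\<close>

lemma regularI:
  fixes ff gg f' g' :: "nat \<Rightarrow> real \<Rightarrow> real"
  assumes "open I" and "is_interval I"
    and "\<And>x. x \<in> I \<Longrightarrow> F x = FF x"
    and "\<And>x. x \<in> I \<Longrightarrow> (FF has_real_derivative F' x) (at x)"
    and "continuous_on I F'"
    and "\<And>k x. k \<in> {1, 2} \<Longrightarrow> x \<in> I \<Longrightarrow> f k x = ff k x \<and> g k x = gg k x"
    and "\<And>k x. k \<in> {1, 2} \<Longrightarrow> x \<in> I \<Longrightarrow> (ff k has_real_derivative f' k x) (at x)"
    and "\<And>k. k \<in> {1, 2} \<Longrightarrow> continuous_on I (f' k)"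
    and "\<And>k x. k \<in> {1, 2} \<Longrightarrow> x \<in> I \<Longrightarrow> (gg k has_real_derivative g' k x) (at x)"
    and "\<And>k. k \<in> {1, 2} \<Longrightarrow> continuous_on I (g' k)"
    and "\<And>k x. k \<in> {1, 2} \<Longrightarrow> x \<in> I \<Longrightarrow> g' k x \<noteq> 0"
    and "\<And>u. u \<in> g 1 ` I + g 2 ` I \<Longrightarrow> G u = GG u"
    and "\<And>u. u \<in> g 1 ` I + g 2 ` I \<Longrightarrow> (GG has_real_derivative G' u) (at u)"
    and "continuous_on (g 1 ` I + g 2 ` I) G'"
  shows "regular I F f G g"
proof -
  have g: "g k C1_differentiable_on I" "\<And>x. x \<in> I \<Longrightarrow> (g k has_real_derivative g' k x) (at x)"
    if "k \<in> {1, 2}" for k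
    by (rule C1_differentiable_onI[OF assms(1) conjunct2[OF assms(6)] assms(9,10)], use that in auto)+
  have f: "f k C1_differentiable_on I" if "k \<in> {1, 2}" for k
    by (rule C1_differentiable_onI(1)[OF assms(1) conjunct1[OF assms(6)] assms(7,8)]) (use that in auto)
  have F: "F C1_differentiable_on I"
    by (rule C1_differentiable_onI(1)[OF assms(1,3,4,5)])
  have "open (g 1 ` I)"
    by (rule open_image_nonzero_deriv[OF assms(1,2) g(2)]) (use assms(11) in auto)
  then have "open (g 1 ` I + g 2 ` I)"
    by (rule open_set_plus)
  then have G: "G C1_differentiable_on (g 1 ` I + g 2 ` I)"
    by (rule C1_differentiable_onI(1)[OF _ assms(12,13,14)])
  have "deriv (g k) x \<noteq> 0" if "k \<in> {1, 2}" "x \<in> I" for k x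
    using assms(11)[OF that] DERIV_imp_deriv[OF g(2)[OF that]] by simp
  then show ?thesis
    unfolding regular_def using F f g G by auto
qed

text \<open>Once the left-hand side of the equation has been written as a function of \<open>g\<^sub>1(x) + g\<^sub>2(y)\<close>, the
  equation says that \<open>G\<close> is this function. It yields both the formula for \<open>G\<close> in the classification
  and the converse.\<close>

lemma solves_iff:
  assumes "\<And>x y. x \<in> I \<Longrightarrow> y \<in> I \<Longrightarrow> F ((x + y) / 2) + f 1 x + f 2 y = H (g 1 x + g 2 y)"
  shows "solves I F f G g \<longleftrightarrow> (\<forall>u \<in> g 1 ` I + g 2 ` I. G u = H u)"
proof -
  have "solves I F f G g \<longleftrightarrow> (\<forall>x\<in>I. \<forall>y\<in>I. G (g 1 x + g 2 y) = H (g 1 x + g 2 y))"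
    unfolding solves_def using assms by metis
  also have "\<dots> \<longleftrightarrow> (\<forall>u \<in> g 1 ` I + g 2 ` I. G u = H u)"
    by (auto simp: set_plus_def)
  finally show ?thesis .
qed

lemma midpoint_mem_interval:
  fixes x y :: real
  assumes "is_interval I" "x \<in> I" "y \<in> I"
  shows "(x + y) / 2 \<in> I"
proof (cases "x \<le> y")
  case True
  then have "x \<le> (x + y) / 2" "(x + y) / 2 \<le> y" by auto
  then show ?thesis using assms unfolding is_interval_1 by blast
next
  case False
  then have "y \<le> (x + y) / 2" "(x + y) / 2 \<le> x" by auto
  then show ?thesis using assms unfolding is_interval_1 by blast
qed

section \<open>Addition theorems behind the solution families\<close>

lemma ln_abs_sin_arctan_add:
  fixes z w :: real
  assumes "z + w \<noteq> 0"
  shows "sin (arctan z + arctan w) \<noteq> 0"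
    and "2 * ln \<bar>sin (arctan z + arctan w)\<bar> = 2 * ln \<bar>z + w\<bar> - ln \<bar>z\<^sup>2 + 1\<bar> - ln \<bar>w\<^sup>2 + 1\<bar>"
proof -
  have s: "sin (arctan z + arctan w) = (z + w) / (sqrt (1 + z\<^sup>2) * sqrt (1 + w\<^sup>2))"
    by (simp add: sin_add sin_arctan cos_arctan add_divide_distrib)
  have pos: "0 < 1 + z\<^sup>2" "0 < 1 + w\<^sup>2" by (auto intro: add_pos_nonneg)
  then show "sin (arctan z + arctan w) \<noteq> 0" using s assms by auto
  have "ln \<bar>sin (arctan z + arctan w)\<bar> = ln \<bar>z + w\<bar> - (ln (1 + z\<^sup>2) / 2 + ln (1 + w\<^sup>2) / 2)"
    unfolding s using pos assms by (simp add: abs_mult ln_div ln_mult ln_sqrt)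
  then show "2 * ln \<bar>sin (arctan z + arctan w)\<bar> = 2 * ln \<bar>z + w\<bar> - ln \<bar>z\<^sup>2 + 1\<bar> - ln \<bar>w\<^sup>2 + 1\<bar>"
    using pos by (simp add: add.commute)
qed

lemma ln_abs_inverse_add:
  fixes z w :: real
  assumes "z + w \<noteq> 0" "z \<noteq> 0" "w \<noteq> 0"
  shows "inverse z + inverse w \<noteq> 0"
    and "ln \<bar>inverse z + inverse w\<bar> = ln \<bar>z + w\<bar> - ln \<bar>z\<bar> - ln \<bar>w\<bar>"
proof -
  have s: "inverse z + inverse w = (z + w) / (z * w)"
    using assms by (simp add: field_simps)
  show "inverse z + inverse w \<noteq> 0" using s assms by simp
  show "ln \<bar>inverse z + inverse w\<bar> = ln \<bar>z + w\<bar> - ln \<bar>z\<bar> - ln \<bar>w\<bar>"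
    unfolding s using assms by (simp add: abs_mult ln_div ln_mult)
qed

lemma exp_half_ln:
  fixes v :: real
  assumes "0 < v"
  shows "exp (ln v / 2) = sqrt v" "exp (- (ln v / 2)) = 1 / sqrt v"
proof -
  show *: "exp (ln v / 2) = sqrt v"
    using assms by (simp flip: ln_sqrt)
  show "exp (- (ln v / 2)) = 1 / sqrt v"
    by (simp add: exp_minus * inverse_eq_divide)
qed

text \<open>With \<open>r = (z - 1)(w - 1) / ((z + 1)(w + 1))\<close>, one has
  \<open>2 \<bar>s v\<bar> = \<bar>r - 1\<bar> / sqrt \<bar>r\<bar>\<close>, where \<open>r - 1 = -2 (z + w) / ((z + 1)(w + 1))\<close>; the sign of \<open>r\<close>, which is
  that of \<open>(z\<^sup>2 - 1)(w\<^sup>2 - 1)\<close>, selects \<open>sinh\<close> or \<open>cosh\<close>.\<close>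

lemma ln_abs_sinh_add:
  fixes z w \<epsilon> :: real
  assumes zw: "z + w \<noteq> 0" and z: "z\<^sup>2 - 1 \<noteq> 0" and w: "w\<^sup>2 - 1 \<noteq> 0"
    and \<epsilon>: "sgn ((z\<^sup>2 - 1) * (w\<^sup>2 - 1)) = \<epsilon>"
  defines "v \<equiv> (ln \<bar>(z - 1) / (z + 1)\<bar> + ln \<bar>(w - 1) / (w + 1)\<bar>) / 2"
    and "s \<equiv> (if \<epsilon> = 1 then sinh else cosh :: real \<Rightarrow> real)"
  shows "s v \<noteq> 0"
    and "2 * ln \<bar>s v\<bar> = 2 * ln \<bar>z + w\<bar> - ln \<bar>z\<^sup>2 - 1\<bar> - ln \<bar>w\<^sup>2 - 1\<bar>"
proof -
  have fac: "z\<^sup>2 - 1 = (z - 1) * (z + 1)" "w\<^sup>2 - 1 = (w - 1) * (w + 1)"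
    by (auto simp: algebra_simps power2_eq_square)
  then have nz: "z - 1 \<noteq> 0" "z + 1 \<noteq> 0" "w - 1 \<noteq> 0" "w + 1 \<noteq> 0" using z w by auto
  define r where "r = ((z - 1) / (z + 1)) * ((w - 1) / (w + 1))"
  have r0: "r \<noteq> 0" using nz by (simp add: r_def)
  have r1: "r - 1 = - 2 * (z + w) / ((z + 1) * (w + 1))"
    using nz by (simp add: r_def divide_simps) (simp add: algebra_simps)
  have "(z\<^sup>2 - 1) * (w\<^sup>2 - 1) = r * ((z + 1) * (w + 1))\<^sup>2"
    unfolding fac r_def using nz by (simp add: power2_eq_square)
  moreover have "0 < ((z + 1) * (w + 1))\<^sup>2"
    using nz by simp
  ultimately have "sgn ((z\<^sup>2 - 1) * (w\<^sup>2 - 1)) = sgn r"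
    by (metis mult.right_neutral sgn_mult sgn_pos)
  then have sgr: "sgn r = \<epsilon>" using \<epsilon> by simp
  have v: "v = ln \<bar>r\<bar> / 2"
    unfolding v_def r_def abs_mult using nz by (subst ln_mult) auto
  have "\<bar>s v\<bar> = \<bar>r - 1\<bar> / (2 * sqrt \<bar>r\<bar>)"
  proof (cases "r > 0")
    case True
    then have "s = sinh" using sgr by (simp add: s_def)
    then have "s v = (sqrt r - 1 / sqrt r) / 2"
      using True unfolding v by (simp add: sinh_field_def exp_half_ln)
    also have "\<dots> = (r - 1) / (2 * sqrt r)"
      using True by (simp add: field_simps)
    finally show ?thesis using True by (simp add: abs_mult)
  next
    case False
    then have "r < 0" using r0 by simp
    then have "s = cosh" using sgr by (auto simp: s_def)
    then have "s v = (sqrt (- r) + 1 / sqrt (- r)) / 2"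
      using \<open>r < 0\<close> exp_half_ln[of "- r"] unfolding v by (simp add: cosh_field_def)
    also have "\<dots> = (1 - r) / (2 * sqrt (- r))"
      using \<open>r < 0\<close> by (simp add: field_simps real_sqrt_mult_self)
    finally show ?thesis using \<open>r < 0\<close> by (simp add: abs_mult)
  qed
  also have "\<dots> = \<bar>z + w\<bar> / (\<bar>z + 1\<bar> * \<bar>w + 1\<bar> * sqrt \<bar>r\<bar>)"
    unfolding r1 abs_divide abs_mult by simp
  finally have sv: "\<bar>s v\<bar> = \<bar>z + w\<bar> / (\<bar>z + 1\<bar> * \<bar>w + 1\<bar> * sqrt \<bar>r\<bar>)" .
  then show "s v \<noteq> 0" using zw nz r0 by auto
  have lr: "ln \<bar>r\<bar> = ln \<bar>z - 1\<bar> - ln \<bar>z + 1\<bar> + (ln \<bar>w - 1\<bar> - ln \<bar>w + 1\<bar>)"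
    unfolding r_def using nz by (simp add: abs_mult ln_mult ln_div)
  have ls: "ln \<bar>s v\<bar> = ln \<bar>z + w\<bar> - (ln \<bar>z + 1\<bar> + ln \<bar>w + 1\<bar> + ln \<bar>r\<bar> / 2)"
    unfolding sv using zw nz r0 by (simp add: ln_mult ln_div ln_sqrt)
  have lz: "ln \<bar>z\<^sup>2 - 1\<bar> = ln \<bar>z - 1\<bar> + ln \<bar>z + 1\<bar>"
    and lw: "ln \<bar>w\<^sup>2 - 1\<bar> = ln \<bar>w - 1\<bar> + ln \<bar>w + 1\<bar>"
    unfolding fac using nz by (simp_all add: abs_mult ln_mult)
  show "2 * ln \<bar>s v\<bar> = 2 * ln \<bar>z + w\<bar> - ln \<bar>z\<^sup>2 - 1\<bar> - ln \<bar>w\<^sup>2 - 1\<bar>"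
    unfolding ls lr lz lw by (simp add: field_simps)
qed

text \<open>Here \<open>z / w = \<epsilon> \<bar>z\<bar> / \<bar>w\<bar>\<close>, so the left-hand side is \<open>ln \<bar>z / w + 1\<bar>\<close>.\<close>

lemma ln_abs_exp_add_sgn:
  fixes z w \<epsilon> :: real
  assumes "z + w \<noteq> 0" "z \<noteq> 0" "w \<noteq> 0" and \<epsilon>: "sgn (z * w) = \<epsilon>"
  shows "exp (ln \<bar>z\<bar> - ln \<bar>w\<bar>) + \<epsilon> \<noteq> 0"
    and "ln \<bar>exp (ln \<bar>z\<bar> - ln \<bar>w\<bar>) + \<epsilon>\<bar> = ln \<bar>z + w\<bar> - ln \<bar>w\<bar>"
proof -
  have e: "exp (ln \<bar>z\<bar> - ln \<bar>w\<bar>) = \<bar>z\<bar> / \<bar>w\<bar>"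
    using assms by (simp add: exp_diff)
  have s: "\<bar>exp (ln \<bar>z\<bar> - ln \<bar>w\<bar>) + \<epsilon>\<bar> = \<bar>z + w\<bar> / \<bar>w\<bar>"
    unfolding e using assms by (cases "z > 0"; cases "w > 0") (auto simp: sgn_mult field_simps)
  show "exp (ln \<bar>z\<bar> - ln \<bar>w\<bar>) + \<epsilon> \<noteq> 0" using s assms by auto
  show "ln \<bar>exp (ln \<bar>z\<bar> - ln \<bar>w\<bar>) + \<epsilon>\<bar> = ln \<bar>z + w\<bar> - ln \<bar>w\<bar>"
    unfolding s using assms by (simp add: ln_div)
qed

section \<open>The solution families\<close>

text \<open>The midpoint enters the logarithmic families only through the sum of the two arguments
  \<open>\<alpha>x + \<beta>\<^sub>1\<close> and \<open>\<alpha>y + \<beta>\<^sub>2\<close>, to which the addition theorems apply.\<close>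

lemma F_log_midpoint:
  fixes b :: "nat \<Rightarrow> real"
  assumes "is_interval I" and "F_log I F A B \<alpha> \<beta> l0" and "b 1 + b 2 = \<beta>"
    and "x \<in> I" and "y \<in> I"
  shows "(\<alpha> * x + b 1) + (\<alpha> * y + b 2) \<noteq> 0"
    and "F ((x + y) / 2) = 2 * A * ln \<bar>(\<alpha> * x + b 1) + (\<alpha> * y + b 2)\<bar> + B * (x + y) + l0"
proof -
  have e: "2 * \<alpha> * ((x + y) / 2) + \<beta> = (\<alpha> * x + b 1) + (\<alpha> * y + b 2)"
    by (simp add: field_simps flip: assms(3))
  have "(x + y) / 2 \<in> I"
    using assms(1,4,5) by (rule midpoint_mem_interval)
  then have *: "2 * \<alpha> * ((x + y) / 2) + \<beta> \<noteq> 0"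
    "F ((x + y) / 2) = 2 * A * ln \<bar>2 * \<alpha> * ((x + y) / 2) + \<beta>\<bar> + 2 * B * ((x + y) / 2) + l0"
    using assms(2) unfolding F_log_def by blast+
  show "(\<alpha> * x + b 1) + (\<alpha> * y + b 2) \<noteq> 0"
    using *(1) unfolding e .
  show "F ((x + y) / 2) = 2 * A * ln \<bar>(\<alpha> * x + b 1) + (\<alpha> * y + b 2)\<bar> + B * (x + y) + l0"
    using *(2) unfolding e by simp
qed

lemma F_log_derivative:
  assumes "F_log I F A B \<alpha> \<beta> l0"
  shows "\<And>x. x \<in> I \<Longrightarrow> F x = 2 * A * ln \<bar>2 * \<alpha> * x + \<beta>\<bar> + 2 * B * x + l0"
    and "\<And>x. x \<in> I \<Longrightarrow> ((\<lambda>x. 2 * A * ln \<bar>2 * \<alpha> * x + \<beta>\<bar> + 2 * B * x + l0)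
           has_real_derivative 2 * A * (2 * \<alpha> / (2 * \<alpha> * x + \<beta>)) + 2 * B) (at x)"
    and "continuous_on I (\<lambda>x. 2 * A * (2 * \<alpha> / (2 * \<alpha> * x + \<beta>)) + 2 * B)"
  using assms unfolding F_log_def
  by (auto intro!: derivative_eq_intros continuous_intros)

lemma G_log_derivative:
  fixes s :: "real \<Rightarrow> real"
  assumes "(s has_real_derivative s') (at u)" and "s u \<noteq> 0" and "D \<noteq> 0"
  shows "((\<lambda>u. 2 * A * ln \<bar>s u\<bar> + C * ((u - \<mu>) / D) + \<Lambda>) has_real_derivative
    2 * A * (s' / s u) + C / D) (at u)"
  by (rule derivative_eq_intros has_real_derivative_ln_abs[OF assms(1,2)] refl | simp add: assms(3))+

lemma P1_1_solves_iff:
  assumes "is_interval I" and F: "F_log I F A B \<alpha> \<beta> l0" and b: "b 1 + b 2 = \<beta>"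
    and D: "D \<noteq> 0"
    and fg: "\<forall>k\<in>{1,2}. \<forall>x\<in>I.
         f k x = - A * ln \<bar>(\<alpha> * x + b k)\<^sup>2 + 1\<bar> - B * x + C * arctan (\<alpha> * x + b k) + l k \<and>
         g k x = D * arctan (\<alpha> * x + b k) + m k"
  shows "solves I F f G g \<longleftrightarrow> P1_1 I f G g A B C D \<alpha> b l0 l m"
proof -
  have "F ((x + y) / 2) + f 1 x + f 2 y =
      (\<lambda>u. 2 * A * ln \<bar>sin ((u - (m 1 + m 2)) / D)\<bar> + C * ((u - (m 1 + m 2)) / D)
         + (l0 + l 1 + l 2)) (g 1 x + g 2 y)" if x: "x \<in> I" and y: "y \<in> I" for x y
  proof -
    define z w where "z = \<alpha> * x + b 1" and "w = \<alpha> * y + b 2"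
    note mid = F_log_midpoint[OF assms(1) F b x y, folded z_def w_def]
    have u: "(g 1 x + g 2 y - (m 1 + m 2)) / D = arctan z + arctan w"
      using fg x y D by (simp add: z_def w_def field_simps)
    have "A * (2 * ln \<bar>sin (arctan z + arctan w)\<bar>) =
        A * (2 * ln \<bar>z + w\<bar> - ln \<bar>z\<^sup>2 + 1\<bar> - ln \<bar>w\<^sup>2 + 1\<bar>)"
      using ln_abs_sin_arctan_add(2)[OF mid(1)] by simp
    moreover have "f 1 x = - A * ln \<bar>z\<^sup>2 + 1\<bar> - B * x + C * arctan z + l 1"
      "f 2 y = - A * ln \<bar>w\<^sup>2 + 1\<bar> - B * y + C * arctan w + l 2"
      using fg x y unfolding z_def w_def by simp_all
    ultimately show ?thesis
      unfolding u mid(2) by (simp add: algebra_simps)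
  qed
  from solves_iff[where F = F and f = f and g = g and G = G, OF this] show ?thesis
    unfolding P1_1_def Let_def using fg by simp
qed

lemma P1_1_regular:
  assumes I: "open I" "is_interval I" and F: "F_log I F A B \<alpha> \<beta> l0"
    and adm: "admissible_constants A D \<alpha> \<beta> b" and P: "P1_1 I f G g A B C D \<alpha> b l0 l m"
  shows "regular I F f G g"
proof -
  have D: "D \<noteq> 0" and \<alpha>: "\<alpha> \<noteq> 0" and b: "b 1 + b 2 = \<beta>"
    using adm unfolding admissible_constants_def by auto
  have fg: "\<forall>k\<in>{1,2}. \<forall>x\<in>I.
         f k x = - A * ln \<bar>(\<alpha> * x + b k)\<^sup>2 + 1\<bar> - B * x + C * arctan (\<alpha> * x + b k) + l k \<and>
         g k x = D * arctan (\<alpha> * x + b k) + m k"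
    and G: "\<forall>u \<in> g 1 ` I + g 2 ` I. G u = 2 * A * ln \<bar>sin ((u - (m 1 + m 2)) / D)\<bar>
          + C * ((u - (m 1 + m 2)) / D) + (l0 + l 1 + l 2)"
    using P unfolding P1_1_def Let_def by blast+
  have nz: "sin ((u - (m 1 + m 2)) / D) \<noteq> 0" if "u \<in> g 1 ` I + g 2 ` I" for u
  proof -
    from that obtain x y where x: "x \<in> I" and y: "y \<in> I" and u: "u = g 1 x + g 2 y"
      by (auto simp: set_plus_def)
    have "(u - (m 1 + m 2)) / D = arctan (\<alpha> * x + b 1) + arctan (\<alpha> * y + b 2)"
      unfolding u using fg x y D by (simp add: field_simps)
    then show ?thesis
      using ln_abs_sin_arctan_add(1)[OF F_log_midpoint(1)[OF I(2) F b x y]] by simp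
  qed
  have pos: "0 < z\<^sup>2 + 1" "z\<^sup>2 + 1 \<noteq> 0" "1 + z\<^sup>2 \<noteq> 0" for z :: real
    using zero_le_power2[of z] by linarith+
  show ?thesis
  proof (rule regularI[OF I,
      where FF = "\<lambda>x. 2 * A * ln \<bar>2 * \<alpha> * x + \<beta>\<bar> + 2 * B * x + l0"
        and F' = "\<lambda>x. 2 * A * (2 * \<alpha> / (2 * \<alpha> * x + \<beta>)) + 2 * B"
        and ff = "\<lambda>k x. - A * ln \<bar>(\<alpha> * x + b k)\<^sup>2 + 1\<bar> - B * x + C * arctan (\<alpha> * x + b k) + l k"
        and f' = "\<lambda>k x. - A * (2 * (\<alpha> * x + b k) * \<alpha> / ((\<alpha> * x + b k)\<^sup>2 + 1)) - B
           + C * (\<alpha> / (1 + (\<alpha> * x + b k)\<^sup>2))"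
        and gg = "\<lambda>k x. D * arctan (\<alpha> * x + b k) + m k"
        and g' = "\<lambda>k x. D * (\<alpha> / (1 + (\<alpha> * x + b k)\<^sup>2))"
        and GG = "\<lambda>u. 2 * A * ln \<bar>sin ((u - (m 1 + m 2)) / D)\<bar>
          + C * ((u - (m 1 + m 2)) / D) + (l0 + l 1 + l 2)"
        and G' = "\<lambda>u. 2 * A * (cos ((u - (m 1 + m 2)) / D) / D / sin ((u - (m 1 + m 2)) / D))
          + C / D"], goal_cases)
    case (1 x) then show ?case by (rule F_log_derivative(1)[OF F])
  next
    case (2 x) then show ?case by (rule F_log_derivative(2)[OF F])
  next
    case 3 then show ?case using F_log_derivative(3)[OF F] .
  next
    case 4 then show ?case using fg by blast
  next
    case 5 then show ?case using pos by (auto intro!: derivative_eq_intros simp: divide_inverse)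
  next
    case 6 then show ?case using pos by (auto intro!: continuous_intros)
  next
    case 7 then show ?case using pos by (auto intro!: derivative_eq_intros simp: divide_inverse)
  next
    case 8 then show ?case using pos by (auto intro!: continuous_intros)
  next
    case 9 then show ?case using pos D \<alpha> by auto
  next
    case 10 then show ?case using G by blast
  next
    case (11 u) then show ?case using nz[of u] D
      by (intro G_log_derivative) (auto intro!: derivative_eq_intros)
  next
    case 12 then show ?case using nz D by (auto intro!: continuous_intros)
  qed
qed

lemma P1_2_solves_iff:
  assumes "is_interval I" and F: "F_log I F A B \<alpha> \<beta> l0" and b: "b 1 + b 2 = \<beta>"
    and D: "D \<noteq> 0"
    and fg: "\<forall>k\<in>{1,2}. \<forall>x\<in>I. \<alpha> * x + b k \<noteq> 0 \<and>
         f k x = - 2 * A * ln \<bar>\<alpha> * x + b k\<bar> - B * x + C * inverse (\<alpha> * x + b k) + l k \<and>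
         g k x = D * inverse (\<alpha> * x + b k) + m k"
  shows "solves I F f G g \<longleftrightarrow> P1_2 I f G g A B C D \<alpha> b l0 l m"
proof -
  have "F ((x + y) / 2) + f 1 x + f 2 y =
      (\<lambda>u. 2 * A * ln \<bar>(u - (m 1 + m 2)) / D\<bar> + C * ((u - (m 1 + m 2)) / D)
         + (l0 + l 1 + l 2)) (g 1 x + g 2 y)" if x: "x \<in> I" and y: "y \<in> I" for x y
  proof -
    define z w where "z = \<alpha> * x + b 1" and "w = \<alpha> * y + b 2"
    note mid = F_log_midpoint[OF assms(1) F b x y, folded z_def w_def]
    have nz: "z \<noteq> 0" "w \<noteq> 0" using fg x y unfolding z_def w_def by auto
    have gz: "g 1 x = D * inverse z + m 1" "g 2 y = D * inverse w + m 2"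
      using fg x y unfolding z_def w_def by auto
    have u: "(g 1 x + g 2 y - (m 1 + m 2)) / D = inverse z + inverse w"
      unfolding gz using D by (simp add: add_divide_distrib)
    have "f 1 x = - 2 * A * ln \<bar>z\<bar> - B * x + C * inverse z + l 1"
      "f 2 y = - 2 * A * ln \<bar>w\<bar> - B * y + C * inverse w + l 2"
      using fg x y unfolding z_def w_def by simp_all
    then show ?thesis
      unfolding u mid(2) ln_abs_inverse_add(2)[OF mid(1) nz] by (simp add: algebra_simps)
  qed
  from solves_iff[where F = F and f = f and g = g and G = G, OF this] show ?thesis
    unfolding P1_2_def Let_def using fg by simp
qed

lemma P1_2_regular:
  assumes I: "open I" "is_interval I" and F: "F_log I F A B \<alpha> \<beta> l0"
    and adm: "admissible_constants A D \<alpha> \<beta> b" and P: "P1_2 I f G g A B C D \<alpha> b l0 l m"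
  shows "regular I F f G g"
proof -
  have D: "D \<noteq> 0" and \<alpha>: "\<alpha> \<noteq> 0" and b: "b 1 + b 2 = \<beta>"
    using adm unfolding admissible_constants_def by auto
  have fg: "\<forall>k\<in>{1,2}. \<forall>x\<in>I. \<alpha> * x + b k \<noteq> 0 \<and>
         f k x = - 2 * A * ln \<bar>\<alpha> * x + b k\<bar> - B * x + C * inverse (\<alpha> * x + b k) + l k \<and>
         g k x = D * inverse (\<alpha> * x + b k) + m k"
    and G: "\<forall>u \<in> g 1 ` I + g 2 ` I. G u = 2 * A * ln \<bar>(u - (m 1 + m 2)) / D\<bar>
          + C * ((u - (m 1 + m 2)) / D) + (l0 + l 1 + l 2)"
    using P unfolding P1_2_def Let_def by blast+
  have zk: "\<alpha> * x + b k \<noteq> 0" if "k \<in> {1,2}" "x \<in> I" for k x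
    using fg that by blast
  have nz: "(u - (m 1 + m 2)) / D \<noteq> 0" if "u \<in> g 1 ` I + g 2 ` I" for u
  proof -
    from that obtain x y where x: "x \<in> I" and y: "y \<in> I" and u: "u = g 1 x + g 2 y"
      by (auto simp: set_plus_def)
    have "g 1 x = D * inverse (\<alpha> * x + b 1) + m 1" "g 2 y = D * inverse (\<alpha> * y + b 2) + m 2"
      using fg x y by auto
    then have "(u - (m 1 + m 2)) / D = inverse (\<alpha> * x + b 1) + inverse (\<alpha> * y + b 2)"
      unfolding u using D by (simp add: add_divide_distrib)
    then show ?thesis
      using ln_abs_inverse_add(1)[OF F_log_midpoint(1)[OF I(2) F b x y] zk zk] x y by simp
  qed
  show ?thesis
  proof (rule regularI[OF I,
      where FF = "\<lambda>x. 2 * A * ln \<bar>2 * \<alpha> * x + \<beta>\<bar> + 2 * B * x + l0"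
        and F' = "\<lambda>x. 2 * A * (2 * \<alpha> / (2 * \<alpha> * x + \<beta>)) + 2 * B"
        and ff = "\<lambda>k x. - 2 * A * ln \<bar>\<alpha> * x + b k\<bar> - B * x + C * inverse (\<alpha> * x + b k) + l k"
        and f' = "\<lambda>k x. - 2 * A * (\<alpha> / (\<alpha> * x + b k)) - B
           + C * - (inverse (\<alpha> * x + b k) * \<alpha> * inverse (\<alpha> * x + b k))"
        and gg = "\<lambda>k x. D * inverse (\<alpha> * x + b k) + m k"
        and g' = "\<lambda>k x. D * - (inverse (\<alpha> * x + b k) * \<alpha> * inverse (\<alpha> * x + b k))"
        and GG = "\<lambda>u. 2 * A * ln \<bar>(u - (m 1 + m 2)) / D\<bar>
          + C * ((u - (m 1 + m 2)) / D) + (l0 + l 1 + l 2)"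
        and G' = "\<lambda>u. 2 * A * (1 / D / ((u - (m 1 + m 2)) / D)) + C / D"], goal_cases)
    case (1 x) then show ?case by (rule F_log_derivative(1)[OF F])
  next
    case (2 x) then show ?case by (rule F_log_derivative(2)[OF F])
  next
    case 3 then show ?case using F_log_derivative(3)[OF F] .
  next
    case 4 then show ?case using fg by blast
  next
    case (5 k x) then show ?case using zk[of k x] by (auto intro!: derivative_eq_intros)
  next
    case (6 k) then show ?case using zk[of k] by (auto intro!: continuous_intros)
  next
    case (7 k x) then show ?case using zk[of k x] by (auto intro!: derivative_eq_intros)
  next
    case (8 k) then show ?case using zk[of k] by (auto intro!: continuous_intros)
  next
    case (9 k x) then show ?case using zk[of k x] D \<alpha> by auto
  next
    case 10 then show ?case using G by blast
  next
    case (11 u) then show ?case using nz[of u] D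
      by (intro G_log_derivative) (auto intro!: derivative_eq_intros)
  next
    case 12 then show ?case using nz D by (auto intro!: continuous_intros)
  qed
qed

lemma P1_3_solves_iff:
  assumes I: "I \<noteq> {}" "is_interval I" and F: "F_log I F A B \<alpha> \<beta> l0" and b: "b 1 + b 2 = \<beta>"
    and D: "D \<noteq> 0"
    and fg: "\<forall>k\<in>{1,2}. \<forall>x\<in>I. (\<alpha> * x + b k)\<^sup>2 - 1 \<noteq> 0 \<and>
         f k x = - A * ln \<bar>(\<alpha> * x + b k)\<^sup>2 - 1\<bar> - B * x
                 + C * (ln \<bar>(\<alpha> * x + b k - 1) / (\<alpha> * x + b k + 1)\<bar>) + l k \<and>
         g k x = D * (ln \<bar>(\<alpha> * x + b k - 1) / (\<alpha> * x + b k + 1)\<bar>) + m k"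
  shows "solves I F f G g \<longleftrightarrow> P1_3 I f G g A B C D \<alpha> b l0 l m"
proof -
  have zk: "(\<alpha> * x + b k)\<^sup>2 - 1 \<noteq> 0" if "k \<in> {1,2}" "x \<in> I" for k x
    using fg that by blast
  obtain \<epsilon> where \<epsilon>: "\<epsilon> \<in> {1, -1}"
    and sg: "\<And>x y. x \<in> I \<Longrightarrow> y \<in> I \<Longrightarrow> sgn (((\<alpha> * x + b 1)\<^sup>2 - 1) * ((\<alpha> * y + b 2)\<^sup>2 - 1)) = \<epsilon>"
    and uniq: "\<And>\<epsilon>'. \<forall>x\<in>I. sgn (((\<alpha> * x + b 1)\<^sup>2 - 1) * ((\<alpha> * x + b 2)\<^sup>2 - 1)) = \<epsilon>' \<Longrightarrow> \<epsilon>' = \<epsilon>"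
    by (rule sgn_product_constant_on_interval[OF I,
          of "\<lambda>x. (\<alpha> * x + b 1)\<^sup>2 - 1" "\<lambda>x. (\<alpha> * x + b 2)\<^sup>2 - 1"])
      (use zk in \<open>auto intro!: continuous_intros\<close>)
  define s where "s = (if \<epsilon> = 1 then sinh else cosh :: real \<Rightarrow> real)"
  have "F ((x + y) / 2) + f 1 x + f 2 y =
      (\<lambda>u. 2 * A * ln \<bar>s ((u - (m 1 + m 2)) / (2 * D))\<bar> + C * ((u - (m 1 + m 2)) / D)
         + (l0 + l 1 + l 2)) (g 1 x + g 2 y)" if x: "x \<in> I" and y: "y \<in> I" for x y
  proof -
    define z w where "z = \<alpha> * x + b 1" and "w = \<alpha> * y + b 2"
    define p q where "p = ln \<bar>(z - 1) / (z + 1)\<bar>" and "q = ln \<bar>(w - 1) / (w + 1)\<bar>"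
    note mid = F_log_midpoint[OF I(2) F b x y, folded z_def w_def]
    have nz: "z\<^sup>2 - 1 \<noteq> 0" "w\<^sup>2 - 1 \<noteq> 0" using zk x y unfolding z_def w_def by auto
    have gz: "g 1 x = D * p + m 1" "g 2 y = D * q + m 2"
      using fg x y unfolding z_def w_def p_def q_def by auto
    have u: "(g 1 x + g 2 y - (m 1 + m 2)) / D = p + q"
      "(g 1 x + g 2 y - (m 1 + m 2)) / (2 * D) = (p + q) / 2"
      unfolding gz using D by (simp_all add: field_simps)
    have "2 * ln \<bar>s ((p + q) / 2)\<bar> = 2 * ln \<bar>z + w\<bar> - ln \<bar>z\<^sup>2 - 1\<bar> - ln \<bar>w\<^sup>2 - 1\<bar>"
      using ln_abs_sinh_add(2)[OF mid(1) nz sg[OF x y, folded z_def w_def]]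
      unfolding p_def q_def s_def .
    then have "A * (2 * ln \<bar>s ((p + q) / 2)\<bar>) =
        A * (2 * ln \<bar>z + w\<bar> - ln \<bar>z\<^sup>2 - 1\<bar> - ln \<bar>w\<^sup>2 - 1\<bar>)"
      by (rule arg_cong)
    moreover have "f 1 x = - A * ln \<bar>z\<^sup>2 - 1\<bar> - B * x + C * p + l 1"
      "f 2 y = - A * ln \<bar>w\<^sup>2 - 1\<bar> - B * y + C * q + l 2"
      using fg x y unfolding z_def w_def p_def q_def by simp_all
    ultimately show ?thesis
      unfolding u mid(2) by (simp add: algebra_simps)
  qed
  from solves_iff[where F = F and f = f and g = g and G = G, OF this]
  have iff: "solves I F f G g \<longleftrightarrow> (\<forall>u \<in> g 1 ` I + g 2 ` I.
     G u = 2 * A * ln \<bar>s ((u - (m 1 + m 2)) / (2 * D))\<bar> + C * ((u - (m 1 + m 2)) / D)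
         + (l0 + l 1 + l 2))" .
  show ?thesis
  proof
    assume sol: "solves I F f G g"
    show "P1_3 I f G g A B C D \<alpha> b l0 l m"
      unfolding P1_3_def Let_def
    proof (intro conjI[OF fg] bexI[where x = \<epsilon>] conjI)
      show "\<forall>x\<in>I. sgn (((\<alpha> * x + b 1)\<^sup>2 - 1) * ((\<alpha> * x + b 2)\<^sup>2 - 1)) = \<epsilon>"
        using sg by blast
    qed (fact sol[unfolded iff s_def], fact \<epsilon>)
  next
    assume "P1_3 I f G g A B C D \<alpha> b l0 l m"
    then obtain \<epsilon>' where sg': "\<forall>x\<in>I. sgn (((\<alpha> * x + b 1)\<^sup>2 - 1) * ((\<alpha> * x + b 2)\<^sup>2 - 1)) = \<epsilon>'"
      and G: "\<forall>u \<in> g 1 ` I + g 2 ` I.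
            G u = 2 * A * ln \<bar>(if \<epsilon>' = 1 then sinh else cosh) ((u - (m 1 + m 2)) / (2 * D))\<bar>
                  + C * ((u - (m 1 + m 2)) / D) + (l0 + l 1 + l 2)"
      unfolding P1_3_def Let_def by blast
    show "solves I F f G g"
      using G unfolding uniq[OF sg'] iff s_def .
  qed
qed

lemma has_real_derivative_ln_fraction:
  fixes \<alpha> \<beta> x :: real
  assumes "(\<alpha> * x + \<beta>)\<^sup>2 - 1 \<noteq> 0"
  shows "((\<lambda>x. ln \<bar>(\<alpha> * x + \<beta> - 1) / (\<alpha> * x + \<beta> + 1)\<bar>) has_real_derivative
    2 * \<alpha> / ((\<alpha> * x + \<beta>)\<^sup>2 - 1)) (at x)"
proof -
  define z where "z = \<alpha> * x + \<beta>"
  have fac: "z\<^sup>2 - 1 = (z - 1) * (z + 1)"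
    by (simp add: power2_eq_square algebra_simps)
  then have nz: "z - 1 \<noteq> 0" "z + 1 \<noteq> 0" using assms unfolding z_def by auto
  have "((\<lambda>x. (\<alpha> * x + \<beta> - 1) / (\<alpha> * x + \<beta> + 1)) has_real_derivative
      (\<alpha> * (z + 1) - (z - 1) * \<alpha>) / ((z + 1) * (z + 1))) (at x)"
    using nz(2) unfolding z_def by (auto intro!: derivative_eq_intros)
  from has_real_derivative_ln_abs[OF this] have
    "((\<lambda>x. ln \<bar>(\<alpha> * x + \<beta> - 1) / (\<alpha> * x + \<beta> + 1)\<bar>) has_real_derivative
      (\<alpha> * (z + 1) - (z - 1) * \<alpha>) / ((z + 1) * (z + 1)) / ((z - 1) / (z + 1))) (at x)"
    using nz by (simp add: z_def)
  moreover have "(\<alpha> * (z + 1) - (z - 1) * \<alpha>) / ((z + 1) * (z + 1)) / ((z - 1) / (z + 1))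
      = 2 * \<alpha> / (z\<^sup>2 - 1)"
    unfolding fac using nz by (simp add: divide_simps) (simp add: algebra_simps)
  ultimately show ?thesis
    by (simp add: z_def)
qed

lemma has_real_derivative_ln_quadratic:
  fixes \<alpha> \<beta> x :: real
  assumes "(\<alpha> * x + \<beta>)\<^sup>2 - 1 \<noteq> 0"
  shows "((\<lambda>x. ln \<bar>(\<alpha> * x + \<beta>)\<^sup>2 - 1\<bar>) has_real_derivative
    2 * (\<alpha> * x + \<beta>) * \<alpha> / ((\<alpha> * x + \<beta>)\<^sup>2 - 1)) (at x)"
proof (rule has_real_derivative_ln_abs[where h = "\<lambda>x. (\<alpha> * x + \<beta>)\<^sup>2 - 1"])
  show "((\<lambda>x. (\<alpha> * x + \<beta>)\<^sup>2 - 1) has_real_derivative 2 * (\<alpha> * x + \<beta>) * \<alpha>) (at x)"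
    by (auto intro!: derivative_eq_intros)
qed (fact assms)

lemma P1_3_regular:
  assumes I: "I \<noteq> {}" "open I" "is_interval I" and F: "F_log I F A B \<alpha> \<beta> l0"
    and adm: "admissible_constants A D \<alpha> \<beta> b" and P: "P1_3 I f G g A B C D \<alpha> b l0 l m"
  shows "regular I F f G g"
proof -
  have D: "D \<noteq> 0" and \<alpha>: "\<alpha> \<noteq> 0" and b: "b 1 + b 2 = \<beta>"
    using adm unfolding admissible_constants_def by auto
  have fg: "\<forall>k\<in>{1,2}. \<forall>x\<in>I. (\<alpha> * x + b k)\<^sup>2 - 1 \<noteq> 0 \<and>
         f k x = - A * ln \<bar>(\<alpha> * x + b k)\<^sup>2 - 1\<bar> - B * x
                 + C * (ln \<bar>(\<alpha> * x + b k - 1) / (\<alpha> * x + b k + 1)\<bar>) + l k \<and>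
         g k x = D * (ln \<bar>(\<alpha> * x + b k - 1) / (\<alpha> * x + b k + 1)\<bar>) + m k"
    using P unfolding P1_3_def Let_def by blast
  obtain \<epsilon> where \<epsilon>: "\<epsilon> \<in> {1, -1}"
    and sg: "\<forall>x\<in>I. sgn (((\<alpha> * x + b 1)\<^sup>2 - 1) * ((\<alpha> * x + b 2)\<^sup>2 - 1)) = \<epsilon>"
    and G: "\<forall>u \<in> g 1 ` I + g 2 ` I.
            G u = 2 * A * ln \<bar>(if \<epsilon> = 1 then sinh else cosh) ((u - (m 1 + m 2)) / (2 * D))\<bar>
                  + C * ((u - (m 1 + m 2)) / D) + (l0 + l 1 + l 2)"
    using P unfolding P1_3_def Let_def by blast
  have zk: "(\<alpha> * x + b k)\<^sup>2 - 1 \<noteq> 0" if "k \<in> {1,2}" "x \<in> I" for k x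
    using fg that by blast
  have sgxy: "sgn (((\<alpha> * x + b 1)\<^sup>2 - 1) * ((\<alpha> * y + b 2)\<^sup>2 - 1)) = \<epsilon>" if "x \<in> I" "y \<in> I" for x y
    by (rule sgn_product_constant_on_interval[OF I(1,3),
          of "\<lambda>x. (\<alpha> * x + b 1)\<^sup>2 - 1" "\<lambda>x. (\<alpha> * x + b 2)\<^sup>2 - 1"])
      (use zk that sg in \<open>auto intro!: continuous_intros\<close>)
  define s t where "s = (if \<epsilon> = 1 then sinh else cosh :: real \<Rightarrow> real)"
    and "t = (if \<epsilon> = 1 then cosh else sinh :: real \<Rightarrow> real)"
  have nz: "s ((u - (m 1 + m 2)) / (2 * D)) \<noteq> 0" if "u \<in> g 1 ` I + g 2 ` I" for u
  proof -
    from that obtain x y where x: "x \<in> I" and y: "y \<in> I" and u: "u = g 1 x + g 2 y"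
      by (auto simp: set_plus_def)
    define z w where "z = \<alpha> * x + b 1" and "w = \<alpha> * y + b 2"
    have "g 1 x = D * (ln \<bar>(z - 1) / (z + 1)\<bar>) + m 1"
      "g 2 y = D * (ln \<bar>(w - 1) / (w + 1)\<bar>) + m 2"
      using fg x y unfolding z_def w_def by auto
    then have v: "(u - (m 1 + m 2)) / (2 * D) = (ln \<bar>(z - 1) / (z + 1)\<bar> + ln \<bar>(w - 1) / (w + 1)\<bar>) / 2"
      unfolding u using D by (simp add: field_simps)
    have "z + w \<noteq> 0" "z\<^sup>2 - 1 \<noteq> 0" "w\<^sup>2 - 1 \<noteq> 0" "sgn ((z\<^sup>2 - 1) * (w\<^sup>2 - 1)) = \<epsilon>"
      using F_log_midpoint(1)[OF I(3) F b x y] zk x y sgxy[OF x y] unfolding z_def w_def by auto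
    from ln_abs_sinh_add(1)[OF this] show ?thesis unfolding v s_def .
  qed
  show ?thesis
  proof (rule regularI[OF I(2,3),
      where FF = "\<lambda>x. 2 * A * ln \<bar>2 * \<alpha> * x + \<beta>\<bar> + 2 * B * x + l0"
        and F' = "\<lambda>x. 2 * A * (2 * \<alpha> / (2 * \<alpha> * x + \<beta>)) + 2 * B"
        and ff = "\<lambda>k x. - A * ln \<bar>(\<alpha> * x + b k)\<^sup>2 - 1\<bar> - B * x
                 + C * (ln \<bar>(\<alpha> * x + b k - 1) / (\<alpha> * x + b k + 1)\<bar>) + l k"
        and f' = "\<lambda>k x. - A * (2 * (\<alpha> * x + b k) * \<alpha> / ((\<alpha> * x + b k)\<^sup>2 - 1)) - B
           + C * (2 * \<alpha> / ((\<alpha> * x + b k)\<^sup>2 - 1))"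
        and gg = "\<lambda>k x. D * (ln \<bar>(\<alpha> * x + b k - 1) / (\<alpha> * x + b k + 1)\<bar>) + m k"
        and g' = "\<lambda>k x. D * (2 * \<alpha> / ((\<alpha> * x + b k)\<^sup>2 - 1))"
        and GG = "\<lambda>u. 2 * A * ln \<bar>s ((u - (m 1 + m 2)) / (2 * D))\<bar>
          + C * ((u - (m 1 + m 2)) / D) + (l0 + l 1 + l 2)"
        and G' = "\<lambda>u. 2 * A * (t ((u - (m 1 + m 2)) / (2 * D)) / (2 * D)
            / s ((u - (m 1 + m 2)) / (2 * D))) + C / D"], goal_cases)
    case (1 x) then show ?case by (rule F_log_derivative(1)[OF F])
  next
    case (2 x) then show ?case by (rule F_log_derivative(2)[OF F])
  next
    case 3 then show ?case using F_log_derivative(3)[OF F] .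
  next
    case 4 then show ?case using fg by blast
  next
    case (5 k x)
    note L = has_real_derivative_ln_fraction[OF zk[OF 5]]
      and Q = has_real_derivative_ln_quadratic[OF zk[OF 5]]
    show ?case by (rule L Q derivative_eq_intros refl | simp add: mult_ac)+
  next
    case (6 k) then show ?case using zk[of k] by (auto intro!: continuous_intros)
  next
    case (7 k x)
    note L = has_real_derivative_ln_fraction[OF zk[OF 7]]
    show ?case by (rule L derivative_eq_intros refl | simp)+
  next
    case (8 k) then show ?case using zk[of k] by (auto intro!: continuous_intros)
  next
    case (9 k x) then show ?case using zk[of k x] D \<alpha> by auto
  next
    case 10 then show ?case using G unfolding s_def by blast
  next
    case (11 u)
    have "(s has_real_derivative t v) (at v)" for v
      unfolding s_def t_def by (auto intro!: derivative_eq_intros)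
    then have "((\<lambda>u. s ((u - (m 1 + m 2)) / (2 * D))) has_real_derivative
        t ((u - (m 1 + m 2)) / (2 * D)) * (1 / (2 * D))) (at u)"
      by (rule DERIV_chain2) (use D in \<open>auto intro!: derivative_eq_intros\<close>)
    from G_log_derivative[OF this nz[OF 11] D] show ?case by simp
  next
    case 12
    have c: "continuous_on S s" "continuous_on S t" for S
      unfolding s_def t_def by (auto intro!: continuous_intros)
    show ?case
      using nz D by (auto intro!: continuous_intros continuous_on_compose2[OF c(1)] continuous_on_compose2[OF c(2)])
  qed
qed

text \<open>The coefficients \<open>A' k\<close> are bound inside the definition of the family, so this lemma (and the one
  for affine \<open>g\<^sub>k\<close> below) characterises only the formula for \<open>G\<close>.\<close>

lemma P1_4_solves_iff:
  assumes I: "I \<noteq> {}" "is_interval I" and F: "F_log I F A B \<alpha> \<beta> l0" and b: "b 1 + b 2 = \<beta>"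
    and D: "D \<noteq> 0" and A': "(A' 1 + A' 2) / 2 = A"
    and fg: "\<forall>k\<in>{1,2}. \<forall>x\<in>I. \<alpha> * x + b k \<noteq> 0 \<and>
         f k x = - A' k * (ln \<bar>\<alpha> * x + b k\<bar>) - B * x + l k \<and>
         g k x = (-1) ^ (k - 1) * D * (ln \<bar>\<alpha> * x + b k\<bar>) + m k"
  shows "solves I F f G g \<longleftrightarrow>
      (\<exists>\<epsilon>\<in>{1, -1}. (\<forall>x\<in>I. sgn ((\<alpha> * x + b 1) * (\<alpha> * x + b 2)) = \<epsilon>) \<and>
         (\<forall>u \<in> g 1 ` I + g 2 ` I.
            G u = 2 * A * (ln \<bar>exp ((u - (m 1 + m 2)) / D) + \<epsilon>\<bar>)
              - A' 1 * ((u - (m 1 + m 2)) / D) + (l0 + l 1 + l 2)))"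
proof -
  have zk: "\<alpha> * x + b k \<noteq> 0" if "k \<in> {1,2}" "x \<in> I" for k x
    using fg that by blast
  obtain \<epsilon> where \<epsilon>: "\<epsilon> \<in> {1, -1}"
    and sg: "\<And>x y. x \<in> I \<Longrightarrow> y \<in> I \<Longrightarrow> sgn ((\<alpha> * x + b 1) * (\<alpha> * y + b 2)) = \<epsilon>"
    and uniq: "\<And>\<epsilon>'. \<forall>x\<in>I. sgn ((\<alpha> * x + b 1) * (\<alpha> * x + b 2)) = \<epsilon>' \<Longrightarrow> \<epsilon>' = \<epsilon>"
    by (rule sgn_product_constant_on_interval[OF I, of "\<lambda>x. \<alpha> * x + b 1" "\<lambda>x. \<alpha> * x + b 2"])
      (use zk in \<open>auto intro!: continuous_intros\<close>)
  have "F ((x + y) / 2) + f 1 x + f 2 y =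
      (\<lambda>u. 2 * A * (ln \<bar>exp ((u - (m 1 + m 2)) / D) + \<epsilon>\<bar>) - A' 1 * ((u - (m 1 + m 2)) / D)
         + (l0 + l 1 + l 2)) (g 1 x + g 2 y)" if x: "x \<in> I" and y: "y \<in> I" for x y
  proof -
    define z w where "z = \<alpha> * x + b 1" and "w = \<alpha> * y + b 2"
    note mid = F_log_midpoint[OF I(2) F b x y, folded z_def w_def]
    have nz: "z \<noteq> 0" "w \<noteq> 0" using zk x y unfolding z_def w_def by auto
    have gz: "g 1 x = D * (ln \<bar>z\<bar>) + m 1" "g 2 y = - D * (ln \<bar>w\<bar>) + m 2"
      using fg x y unfolding z_def w_def by auto
    have u: "(g 1 x + g 2 y - (m 1 + m 2)) / D = ln \<bar>z\<bar> - ln \<bar>w\<bar>"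
      unfolding gz using D by (simp add: field_simps)
    have fz: "f 1 x = - A' 1 * (ln \<bar>z\<bar>) - B * x + l 1"
      "f 2 y = - A' 2 * (ln \<bar>w\<bar>) - B * y + l 2"
      using fg x y unfolding z_def w_def by auto
    have A2: "A' 2 = 2 * A - A' 1" using A' by simp
    show ?thesis
      unfolding u mid(2) ln_abs_exp_add_sgn(2)[OF mid(1) nz sg[OF x y, folded z_def w_def]] fz A2
      by (simp add: algebra_simps)
  qed
  from solves_iff[where F = F and f = f and g = g and G = G, OF this]
  have iff: "solves I F f G g \<longleftrightarrow> (\<forall>u \<in> g 1 ` I + g 2 ` I.
     G u = 2 * A * (ln \<bar>exp ((u - (m 1 + m 2)) / D) + \<epsilon>\<bar>) - A' 1 * ((u - (m 1 + m 2)) / D)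
         + (l0 + l 1 + l 2))" .
  show ?thesis
  proof
    assume sol: "solves I F f G g"
    show "\<exists>\<epsilon>\<in>{1, -1}. (\<forall>x\<in>I. sgn ((\<alpha> * x + b 1) * (\<alpha> * x + b 2)) = \<epsilon>) \<and>
         (\<forall>u \<in> g 1 ` I + g 2 ` I.
            G u = 2 * A * (ln \<bar>exp ((u - (m 1 + m 2)) / D) + \<epsilon>\<bar>)
              - A' 1 * ((u - (m 1 + m 2)) / D) + (l0 + l 1 + l 2))"
    proof (intro bexI[where x = \<epsilon>] conjI)
      show "\<forall>x\<in>I. sgn ((\<alpha> * x + b 1) * (\<alpha> * x + b 2)) = \<epsilon>"
        using sg by blast
    qed (fact sol[unfolded iff], fact \<epsilon>)
  next
    assume "\<exists>\<epsilon>\<in>{1, -1}. (\<forall>x\<in>I. sgn ((\<alpha> * x + b 1) * (\<alpha> * x + b 2)) = \<epsilon>) \<and>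
         (\<forall>u \<in> g 1 ` I + g 2 ` I.
            G u = 2 * A * (ln \<bar>exp ((u - (m 1 + m 2)) / D) + \<epsilon>\<bar>)
              - A' 1 * ((u - (m 1 + m 2)) / D) + (l0 + l 1 + l 2))"
    then show "solves I F f G g"
      unfolding iff using uniq by blast
  qed
qed

lemma P1_4_regular:
  assumes I: "I \<noteq> {}" "open I" "is_interval I" and F: "F_log I F A B \<alpha> \<beta> l0"
    and adm: "admissible_constants A D \<alpha> \<beta> b" and P: "P1_4 I f G g A B D \<alpha> b l0 l m"
  shows "regular I F f G g"
proof -
  have D: "D \<noteq> 0" and \<alpha>: "\<alpha> \<noteq> 0" and b: "b 1 + b 2 = \<beta>"
    using adm unfolding admissible_constants_def by auto
  obtain A' where fg: "\<forall>k\<in>{1,2}. \<forall>x\<in>I. \<alpha> * x + b k \<noteq> 0 \<and>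
         f k x = - A' k * (ln \<bar>\<alpha> * x + b k\<bar>) - B * x + l k \<and>
         g k x = (-1) ^ (k - 1) * D * (ln \<bar>\<alpha> * x + b k\<bar>) + m k"
    and ex: "\<exists>\<epsilon>\<in>{1, -1}. (\<forall>x\<in>I. sgn ((\<alpha> * x + b 1) * (\<alpha> * x + b 2)) = \<epsilon>) \<and>
         (\<forall>u \<in> g 1 ` I + g 2 ` I.
            G u = 2 * A * (ln \<bar>exp ((u - (m 1 + m 2)) / D) + \<epsilon>\<bar>)
              - A' 1 * ((u - (m 1 + m 2)) / D) + (l0 + l 1 + l 2))"
    using P unfolding P1_4_def Let_def by blast
  from ex obtain \<epsilon> where \<epsilon>: "\<epsilon> \<in> {1, -1}"
    and sg: "\<forall>x\<in>I. sgn ((\<alpha> * x + b 1) * (\<alpha> * x + b 2)) = \<epsilon>"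
    and G: "\<forall>u \<in> g 1 ` I + g 2 ` I.
            G u = 2 * A * (ln \<bar>exp ((u - (m 1 + m 2)) / D) + \<epsilon>\<bar>)
              - A' 1 * ((u - (m 1 + m 2)) / D) + (l0 + l 1 + l 2)"
    by blast
  have zk: "\<alpha> * x + b k \<noteq> 0" if "k \<in> {1,2}" "x \<in> I" for k x
    using fg that by blast
  have sgxy: "sgn ((\<alpha> * x + b 1) * (\<alpha> * y + b 2)) = \<epsilon>" if "x \<in> I" "y \<in> I" for x y
    by (rule sgn_product_constant_on_interval[OF I(1,3),
          of "\<lambda>x. \<alpha> * x + b 1" "\<lambda>x. \<alpha> * x + b 2"])
      (use zk that sg in \<open>auto intro!: continuous_intros\<close>)
  have nz: "exp ((u - (m 1 + m 2)) / D) + \<epsilon> \<noteq> 0" if "u \<in> g 1 ` I + g 2 ` I" for u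
  proof -
    from that obtain x y where x: "x \<in> I" and y: "y \<in> I" and u: "u = g 1 x + g 2 y"
      by (auto simp: set_plus_def)
    have "g 1 x = D * (ln \<bar>\<alpha> * x + b 1\<bar>) + m 1" "g 2 y = - D * (ln \<bar>\<alpha> * y + b 2\<bar>) + m 2"
      using fg x y by auto
    then have v: "(u - (m 1 + m 2)) / D = ln \<bar>\<alpha> * x + b 1\<bar> - ln \<bar>\<alpha> * y + b 2\<bar>"
      unfolding u using D by (simp add: field_simps)
    show ?thesis
      unfolding v
      by (rule ln_abs_exp_add_sgn(1)[OF F_log_midpoint(1)[OF I(3) F b x y] zk zk sgxy])
        (use x y in auto)
  qed
  show ?thesis
  proof (rule regularI[OF I(2,3),
      where FF = "\<lambda>x. 2 * A * ln \<bar>2 * \<alpha> * x + \<beta>\<bar> + 2 * B * x + l0"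
        and F' = "\<lambda>x. 2 * A * (2 * \<alpha> / (2 * \<alpha> * x + \<beta>)) + 2 * B"
        and ff = "\<lambda>k x. - A' k * (ln \<bar>\<alpha> * x + b k\<bar>) - B * x + l k"
        and f' = "\<lambda>k x. - A' k * (\<alpha> / (\<alpha> * x + b k)) - B"
        and gg = "\<lambda>k x. (-1) ^ (k - 1) * D * (ln \<bar>\<alpha> * x + b k\<bar>) + m k"
        and g' = "\<lambda>k x. (-1) ^ (k - 1) * D * (\<alpha> / (\<alpha> * x + b k))"
        and GG = "\<lambda>u. 2 * A * ln \<bar>exp ((u - (m 1 + m 2)) / D) + \<epsilon>\<bar>
          + - A' 1 * ((u - (m 1 + m 2)) / D) + (l0 + l 1 + l 2)"
        and G' = "\<lambda>u. 2 * A * (exp ((u - (m 1 + m 2)) / D) * (1 / D)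
            / (exp ((u - (m 1 + m 2)) / D) + \<epsilon>)) + - A' 1 / D"], goal_cases)
    case (1 x) then show ?case by (rule F_log_derivative(1)[OF F])
  next
    case (2 x) then show ?case by (rule F_log_derivative(2)[OF F])
  next
    case 3 then show ?case using F_log_derivative(3)[OF F] .
  next
    case 4 then show ?case using fg by blast
  next
    case (5 k x) then show ?case using zk[of k x] by (auto intro!: derivative_eq_intros)
  next
    case (6 k) then show ?case using zk[of k] by (auto intro!: continuous_intros)
  next
    case (7 k x) then show ?case using zk[of k x] by (auto intro!: derivative_eq_intros)
  next
    case (8 k) then show ?case using zk[of k] by (auto intro!: continuous_intros)
  next
    case (9 k x) then show ?case using zk[of k x] D \<alpha> by auto
  next
    case 10 then show ?case using G by simp
  next
    case (11 u) then show ?case using nz[of u] D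
      by (intro G_log_derivative) (auto intro!: derivative_eq_intros)
  next
    case 12 then show ?case using nz D by (auto intro!: continuous_intros)
  qed
qed

lemma P2_1_solves_iff:
  assumes DD: "D' 1 * D' 2 \<noteq> 0"
    and rel: "\<forall>k\<in>{1,2}. D' 1 * D' 2 * (A + 4 * A' k) = (D' k)\<^sup>2 * A \<and> B + 2 * B' k = 2 * D' k * C"
    and I: "is_interval I"
    and F: "\<forall>x\<in>I. F x = A * x\<^sup>2 + B * x + l0"
    and fg: "\<forall>k\<in>{1,2}. \<forall>x\<in>I.
         f k x = A' k * x\<^sup>2 + B' k * x + l k \<and> g k x = D' k * x + m k"
  shows "solves I F f G g \<longleftrightarrow>
      (\<forall>u \<in> g 1 ` I + g 2 ` I. G u = 1 / (4 * D' 1 * D' 2) * A * (u - (m 1 + m 2))\<^sup>2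
        + C * (u - (m 1 + m 2)) + (l0 + l 1 + l 2))"
proof (rule solves_iff)
  fix x y assume x: "x \<in> I" and y: "y \<in> I"
  define d e where "d = D' 1" and "e = D' 2"
  have de: "d \<noteq> 0" "e \<noteq> 0" using DD unfolding d_def e_def by auto
  have "d * (e * (A + 4 * A' 1)) = d * (d * A)" "e * (d * (A + 4 * A' 2)) = e * (e * A)"
    using rel unfolding d_def e_def by (auto simp: power2_eq_square mult_ac)
  then have "e * (A + 4 * A' 1) = d * A" "d * (A + 4 * A' 2) = e * A"
    unfolding mult_left_cancel[OF de(1)] mult_left_cancel[OF de(2)] .
  then have A: "A' 1 = (A * d / e - A) / 4" "A' 2 = (A * e / d - A) / 4"
    using de by (auto simp: field_simps)
  have B: "B' 1 = d * C - B / 2" "B' 2 = e * C - B / 2"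
    using rel unfolding d_def e_def by auto
  have "(x + y) / 2 \<in> I" using I x y by (rule midpoint_mem_interval)
  then have Fm: "F ((x + y) / 2) = A * ((x + y) / 2)\<^sup>2 + B * ((x + y) / 2) + l0" using F by blast
  have fz: "f 1 x = A' 1 * x\<^sup>2 + B' 1 * x + l 1" "f 2 y = A' 2 * y\<^sup>2 + B' 2 * y + l 2"
    and u: "g 1 x + g 2 y - (m 1 + m 2) = d * x + e * y"
    using fg x y unfolding d_def e_def by auto
  show "F ((x + y) / 2) + f 1 x + f 2 y =
      1 / (4 * D' 1 * D' 2) * A * (g 1 x + g 2 y - (m 1 + m 2))\<^sup>2
        + C * (g 1 x + g 2 y - (m 1 + m 2)) + (l0 + l 1 + l 2)"
    unfolding Fm fz u A B d_def[symmetric] e_def[symmetric]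
    using de by (simp add: field_simps power2_eq_square)
qed

lemma P2_1_regular:
  assumes I: "open I" "is_interval I" and P: "P2_1 I F f G g A B C l0 l m"
  shows "regular I F f G g"
proof -
  obtain A' B' D' where DD: "D' 1 * D' 2 \<noteq> 0"
    and F: "\<forall>x\<in>I. F x = A * x\<^sup>2 + B * x + l0"
    and fg: "\<forall>k\<in>{1,2}. \<forall>x\<in>I.
         f k x = A' k * x\<^sup>2 + B' k * x + l k \<and> g k x = D' k * x + m k"
    and G: "\<forall>u \<in> g 1 ` I + g 2 ` I. G u = 1 / (4 * D' 1 * D' 2) * A * (u - (m 1 + m 2))\<^sup>2
        + C * (u - (m 1 + m 2)) + (l0 + l 1 + l 2)"
    using P unfolding P2_1_def Let_def by metis
  show ?thesis
  proof (rule regularI[OF I,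
      where FF = "\<lambda>x. A * x\<^sup>2 + B * x + l0"
        and F' = "\<lambda>x. A * (2 * x) + B"
        and ff = "\<lambda>k x. A' k * x\<^sup>2 + B' k * x + l k"
        and f' = "\<lambda>k x. A' k * (2 * x) + B' k"
        and gg = "\<lambda>k x. D' k * x + m k"
        and g' = "\<lambda>k x. D' k"
        and GG = "\<lambda>u. 1 / (4 * D' 1 * D' 2) * A * (u - (m 1 + m 2))\<^sup>2
        + C * (u - (m 1 + m 2)) + (l0 + l 1 + l 2)"
        and G' = "\<lambda>u. 1 / (4 * D' 1 * D' 2) * A * (2 * (u - (m 1 + m 2))) + C"], goal_cases)
    case (1 x) then show ?case using F by blast
  next
    case (2 x) then show ?case by (auto intro!: derivative_eq_intros)
  next
    case 3 then show ?case by (auto intro!: continuous_intros)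
  next
    case 4 then show ?case using fg by blast
  next
    case (5 k x) then show ?case by (auto intro!: derivative_eq_intros)
  next
    case (6 k) then show ?case by (auto intro!: continuous_intros)
  next
    case (7 k x) then show ?case by (auto intro!: derivative_eq_intros)
  next
    case (8 k) then show ?case by (auto intro!: continuous_intros)
  next
    case (9 k x) then show ?case using DD by auto
  next
    case 10 then show ?case using G by blast
  next
    case (11 u) then show ?case using DD by (auto intro!: derivative_eq_intros)
  next
    case 12 then show ?case using DD by (auto intro!: continuous_intros)
  qed
qed

lemma P2_2_solves_iff:
  assumes I: "I \<noteq> {}" "is_interval I" and b: "b 1 + b 2 = \<beta>" and D: "D \<noteq> 0"
    and F: "\<forall>x\<in>I. F x = A * (2 * x + \<beta>)\<^sup>2 + 2 * B * x + l0"
    and fg: "\<forall>k\<in>{1,2}. \<forall>x\<in>I. x + b k \<noteq> 0 \<and>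
         f k x = - A * (x + b k)\<^sup>2 - B * x + C * (ln \<bar>x + b k\<bar>) + l k \<and>
         g k x = D * (ln \<bar>x + b k\<bar>) + m k"
  shows "solves I F f G g \<longleftrightarrow> P2_2 I F f G g A B C D \<beta> b l0 l m"
proof -
  have zk: "x + b k \<noteq> 0" if "k \<in> {1,2}" "x \<in> I" for k x
    using fg that by blast
  obtain \<epsilon> where \<epsilon>: "\<epsilon> \<in> {1, -1}"
    and sg: "\<And>x y. x \<in> I \<Longrightarrow> y \<in> I \<Longrightarrow> sgn ((x + b 1) * (y + b 2)) = \<epsilon>"
    and uniq: "\<And>\<epsilon>'. \<forall>x\<in>I. sgn ((x + b 1) * (x + b 2)) = \<epsilon>' \<Longrightarrow> \<epsilon>' = \<epsilon>"
    by (rule sgn_product_constant_on_interval[OF I, of "\<lambda>x. x + b 1" "\<lambda>x. x + b 2"])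
      (use zk in \<open>auto intro!: continuous_intros\<close>)
  have "F ((x + y) / 2) + f 1 x + f 2 y =
      (\<lambda>u. 2 * A * \<epsilon> * exp ((u - (m 1 + m 2)) / D) + C * ((u - (m 1 + m 2)) / D)
         + (l0 + l 1 + l 2)) (g 1 x + g 2 y)" if x: "x \<in> I" and y: "y \<in> I" for x y
  proof -
    define z w where "z = x + b 1" and "w = y + b 2"
    have nz: "z \<noteq> 0" "w \<noteq> 0" using zk x y unfolding z_def w_def by auto
    have gz: "g 1 x = D * (ln \<bar>z\<bar>) + m 1" "g 2 y = D * (ln \<bar>w\<bar>) + m 2"
      using fg x y unfolding z_def w_def by auto
    have u: "(g 1 x + g 2 y - (m 1 + m 2)) / D = ln \<bar>z\<bar> + ln \<bar>w\<bar>"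
      unfolding gz using D by (simp add: field_simps)
    have fz: "f 1 x = - A * z\<^sup>2 - B * x + C * (ln \<bar>z\<bar>) + l 1"
      "f 2 y = - A * w\<^sup>2 - B * y + C * (ln \<bar>w\<bar>) + l 2"
      using fg x y unfolding z_def w_def by auto
    have "2 * ((x + y) / 2) + \<beta> = z + w" unfolding z_def w_def by (simp flip: b)
    moreover have "(x + y) / 2 \<in> I" using I(2) x y by (rule midpoint_mem_interval)
    ultimately have Fm: "F ((x + y) / 2) = A * (z + w)\<^sup>2 + B * (x + y) + l0"
      using F by auto
    have e: "\<epsilon> * exp (ln \<bar>z\<bar> + ln \<bar>w\<bar>) = z * w"
      using nz unfolding sg[OF x y, folded z_def w_def, symmetric]
      by (simp add: exp_add mult_sgn_abs flip: abs_mult)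
    then have E: "2 * A * \<epsilon> * exp (ln \<bar>z\<bar> + ln \<bar>w\<bar>) = 2 * A * (z * w)"
      by (simp only: mult.assoc)
    show ?thesis
      unfolding u Fm fz E by (simp add: algebra_simps power2_eq_square)
  qed
  from solves_iff[where F = F and f = f and g = g and G = G, OF this]
  have iff: "solves I F f G g \<longleftrightarrow> (\<forall>u \<in> g 1 ` I + g 2 ` I.
     G u = 2 * A * \<epsilon> * exp ((u - (m 1 + m 2)) / D) + C * ((u - (m 1 + m 2)) / D)
         + (l0 + l 1 + l 2))" .
  show ?thesis
  proof
    assume sol: "solves I F f G g"
    show "P2_2 I F f G g A B C D \<beta> b l0 l m"
      unfolding P2_2_def Let_def
    proof (intro conjI[OF F] conjI[OF fg] bexI[where x = \<epsilon>] conjI)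
      show "\<forall>x\<in>I. sgn ((x + b 1) * (x + b 2)) = \<epsilon>"
        using sg by blast
    qed (fact sol[unfolded iff], fact \<epsilon>)
  next
    assume "P2_2 I F f G g A B C D \<beta> b l0 l m"
    then obtain \<epsilon>' where sg': "\<forall>x\<in>I. sgn ((x + b 1) * (x + b 2)) = \<epsilon>'"
      and G: "\<forall>u \<in> g 1 ` I + g 2 ` I.
            G u = 2 * A * \<epsilon>' * exp ((u - (m 1 + m 2)) / D) + C * ((u - (m 1 + m 2)) / D)
              + (l0 + l 1 + l 2)"
      unfolding P2_2_def Let_def by blast
    show "solves I F f G g"
      using G unfolding uniq[OF sg'] iff .
  qed
qed

lemma P2_2_regular:
  assumes I: "open I" "is_interval I" and D: "D \<noteq> 0"
    and P: "P2_2 I F f G g A B C D \<beta> b l0 l m"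
  shows "regular I F f G g"
proof -
  have F: "\<forall>x\<in>I. F x = A * (2 * x + \<beta>)\<^sup>2 + 2 * B * x + l0"
    and fg: "\<forall>k\<in>{1,2}. \<forall>x\<in>I. x + b k \<noteq> 0 \<and>
         f k x = - A * (x + b k)\<^sup>2 - B * x + C * (ln \<bar>x + b k\<bar>) + l k \<and>
         g k x = D * (ln \<bar>x + b k\<bar>) + m k"
    using P unfolding P2_2_def Let_def by blast+
  obtain \<epsilon> where G: "\<forall>u \<in> g 1 ` I + g 2 ` I.
            G u = 2 * A * \<epsilon> * exp ((u - (m 1 + m 2)) / D) + C * ((u - (m 1 + m 2)) / D)
              + (l0 + l 1 + l 2)"
    using P unfolding P2_2_def Let_def by blast
  have zk: "x + b k \<noteq> 0" if "k \<in> {1,2}" "x \<in> I" for k x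
    using fg that by blast
  show ?thesis
  proof (rule regularI[OF I,
      where FF = "\<lambda>x. A * (2 * x + \<beta>)\<^sup>2 + 2 * B * x + l0"
        and F' = "\<lambda>x. A * (2 * (2 * x + \<beta>) * 2) + 2 * B"
        and ff = "\<lambda>k x. - A * (x + b k)\<^sup>2 - B * x + C * (ln \<bar>x + b k\<bar>) + l k"
        and f' = "\<lambda>k x. - A * (2 * (x + b k)) - B + C * (1 / (x + b k))"
        and gg = "\<lambda>k x. D * (ln \<bar>x + b k\<bar>) + m k"
        and g' = "\<lambda>k x. D * (1 / (x + b k))"
        and GG = "\<lambda>u. 2 * A * \<epsilon> * exp ((u - (m 1 + m 2)) / D) + C * ((u - (m 1 + m 2)) / D)
              + (l0 + l 1 + l 2)"
        and G' = "\<lambda>u. 2 * A * \<epsilon> * (exp ((u - (m 1 + m 2)) / D) / D) + C / D"], goal_cases)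
    case (1 x) then show ?case using F by blast
  next
    case (2 x) then show ?case by (auto intro!: derivative_eq_intros)
  next
    case 3 then show ?case by (auto intro!: continuous_intros)
  next
    case 4 then show ?case using fg by blast
  next
    case (5 k x) then show ?case using zk[of k x] by (auto intro!: derivative_eq_intros)
  next
    case (6 k) then show ?case using zk[of k] by (auto intro!: continuous_intros)
  next
    case (7 k x) then show ?case using zk[of k x] by (auto intro!: derivative_eq_intros)
  next
    case (8 k) then show ?case using zk[of k] by (auto intro!: continuous_intros)
  next
    case (9 k x) then show ?case using zk[of k x] D by auto
  next
    case 10 then show ?case using G by blast
  next
    case (11 u) then show ?case using D by (auto intro!: derivative_eq_intros)
  next
    case 12 then show ?case using D by (auto intro!: continuous_intros)
  qed
qed

lemma solution_families_regular_solution: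
  assumes I: "I \<noteq> {}" "open I" "is_interval I" and adm: "admissible_constants A D \<alpha> \<beta> b"
    and P: "(F_log I F A B \<alpha> \<beta> l0 \<and>
            (P1_1 I f G g A B C D \<alpha> b l0 l m \<or> P1_2 I f G g A B C D \<alpha> b l0 l m \<or>
             P1_3 I f G g A B C D \<alpha> b l0 l m \<or> P1_4 I f G g A B D \<alpha> b l0 l m)) \<or>
         (P2_1 I F f G g A B C l0 l m \<or> P2_2 I F f G g A B C D \<beta> b l0 l m)"
  shows "regular_solution I F f G g"
proof -
  have D: "D \<noteq> 0" and b: "b 1 + b 2 = \<beta>"
    using adm unfolding admissible_constants_def by auto
  from P consider
      (1) "F_log I F A B \<alpha> \<beta> l0" "P1_1 I f G g A B C D \<alpha> b l0 l m"
    | (2) "F_log I F A B \<alpha> \<beta> l0" "P1_2 I f G g A B C D \<alpha> b l0 l m"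
    | (3) "F_log I F A B \<alpha> \<beta> l0" "P1_3 I f G g A B C D \<alpha> b l0 l m"
    | (4) "F_log I F A B \<alpha> \<beta> l0" "P1_4 I f G g A B D \<alpha> b l0 l m"
    | (5) "P2_1 I F f G g A B C l0 l m"
    | (6) "P2_2 I F f G g A B C D \<beta> b l0 l m"
    by blast
  then show ?thesis
    unfolding regular_solution_def
  proof cases
    case 1
    have "solves I F f G g"
      by (rule P1_1_solves_iff[OF I(3) 1(1) b D 1(2)[unfolded P1_1_def Let_def, THEN conjunct1],
            THEN iffD2, OF 1(2)])
    with P1_1_regular[OF I(2,3) 1(1) adm 1(2)] show "regular I F f G g \<and> solves I F f G g" ..
  next
    case 2
    have "solves I F f G g"
      by (rule P1_2_solves_iff[OF I(3) 2(1) b D 2(2)[unfolded P1_2_def Let_def, THEN conjunct1],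
            THEN iffD2, OF 2(2)])
    with P1_2_regular[OF I(2,3) 2(1) adm 2(2)] show "regular I F f G g \<and> solves I F f G g" ..
  next
    case 3
    have "solves I F f G g"
      by (rule P1_3_solves_iff[OF I(1,3) 3(1) b D 3(2)[unfolded P1_3_def Let_def, THEN conjunct1],
            THEN iffD2, OF 3(2)])
    with P1_3_regular[OF I 3(1) adm 3(2)] show "regular I F f G g \<and> solves I F f G g" ..
  next
    case 4
    from 4(2) obtain A' where fam: "(A' 1 + A' 2) / 2 = A"
      "\<forall>k\<in>{1,2}. \<forall>x\<in>I. \<alpha> * x + b k \<noteq> 0 \<and>
         f k x = - A' k * (ln \<bar>\<alpha> * x + b k\<bar>) - B * x + l k \<and>
         g k x = (-1) ^ (k - 1) * D * (ln \<bar>\<alpha> * x + b k\<bar>) + m k"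
      "\<exists>\<epsilon>\<in>{1, -1}. (\<forall>x\<in>I. sgn ((\<alpha> * x + b 1) * (\<alpha> * x + b 2)) = \<epsilon>) \<and>
         (\<forall>u \<in> g 1 ` I + g 2 ` I.
            G u = 2 * A * (ln \<bar>exp ((u - (m 1 + m 2)) / D) + \<epsilon>\<bar>)
              - A' 1 * ((u - (m 1 + m 2)) / D) + (l0 + l 1 + l 2))"
      unfolding P1_4_def Let_def by blast
    have "solves I F f G g"
      by (rule P1_4_solves_iff[OF I(1,3) 4(1) b D fam(1,2), THEN iffD2, OF fam(3)])
    with P1_4_regular[OF I 4(1) adm 4(2)] show "regular I F f G g \<and> solves I F f G g" ..
  next
    case 5
    then obtain A' B' D' where fam: "D' 1 * D' 2 \<noteq> 0"
      "\<forall>k\<in>{1,2}. D' 1 * D' 2 * (A + 4 * A' k) = (D' k)\<^sup>2 * A \<and> B + 2 * B' k = 2 * D' k * C"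
      "\<forall>x\<in>I. F x = A * x\<^sup>2 + B * x + l0"
      "\<forall>k\<in>{1,2}. \<forall>x\<in>I. f k x = A' k * x\<^sup>2 + B' k * x + l k \<and> g k x = D' k * x + m k"
      "\<forall>u \<in> g 1 ` I + g 2 ` I. G u = 1 / (4 * D' 1 * D' 2) * A * (u - (m 1 + m 2))\<^sup>2
        + C * (u - (m 1 + m 2)) + (l0 + l 1 + l 2)"
      unfolding P2_1_def Let_def by metis
    have "solves I F f G g"
      by (rule P2_1_solves_iff[OF fam(1,2) I(3) fam(3,4), THEN iffD2, OF fam(5)])
    with P2_1_regular[OF I(2,3) 5] show "regular I F f G g \<and> solves I F f G g" ..
  next
    case 6
    note fam = 6[unfolded P2_2_def Let_def]
    have "solves I F f G g"
      by (rule P2_2_solves_iff[OF I(1,3) b D fam[THEN conjunct1]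
            fam[THEN conjunct2, THEN conjunct1], THEN iffD2, OF 6])
    with P2_2_regular[OF I(2,3) D 6] show "regular I F f G g \<and> solves I F f G g" ..
  qed
qed

section \<open>The functional equation for the derivatives\<close>

text \<open>Differentiating the equation in \<open>x\<close> and in \<open>y\<close> gives two expressions for \<open>G'\<close> at
  \<open>g\<^sub>1(x) + g\<^sub>2(y)\<close>; equating them eliminates \<open>G\<close>.\<close>

lemma regular_solution_derivative_equation:
  assumes I: "open I" "is_interval I" and sol: "regular_solution I F f G g"
    and x: "x \<in> I" and y: "y \<in> I"
  shows "phi F ((x + y) / 2) * (1 / deriv (g 1) x - 1 / deriv (g 2) y) =
      - (deriv (f 1) x / deriv (g 1) x) + deriv (f 2) y / deriv (g 2) y"
proof -
  have reg: "F C1_differentiable_on I" "\<And>k. k \<in> {1, 2} \<Longrightarrow> f k C1_differentiable_on I"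
    "\<And>k. k \<in> {1, 2} \<Longrightarrow> g k C1_differentiable_on I" "G C1_differentiable_on (g 1 ` I + g 2 ` I)"
    and nz: "deriv (g 1) x \<noteq> 0" "deriv (g 2) y \<noteq> 0"
    and eq: "\<And>s t. s \<in> I \<Longrightarrow> t \<in> I \<Longrightarrow> F ((s + t) / 2) + f 1 s + f 2 t = G (g 1 s + g 2 t)"
    using sol x y unfolding regular_solution_def regular_def solves_def by auto
  define u v where "u = (x + y) / 2" and "v = g 1 x + g 2 y"
  have uI: "u \<in> I" unfolding u_def using I(2) x y by (rule midpoint_mem_interval)
  have vI: "v \<in> g 1 ` I + g 2 ` I" unfolding v_def using x y by (auto simp: set_plus_def)
  have dF: "(F has_real_derivative deriv F u) (at u)"
    by (rule C1_differentiable_on_DERIV[OF reg(1) uI])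
  have dG: "(G has_real_derivative deriv G v) (at v)"
    by (rule C1_differentiable_on_DERIV[OF reg(4) vI])
  have df: "(f k has_real_derivative deriv (f k) t) (at t)"
    and dg: "(g k has_real_derivative deriv (g k) t) (at t)" if "k \<in> {1, 2}" "t \<in> I" for k t
    using C1_differentiable_on_DERIV reg(2,3) that by blast+
  have 1: "deriv F u * (1 / 2) + deriv (f 1) x = deriv G v * deriv (g 1) x"
  proof (rule DERIV_unique)
    show "((\<lambda>s. G (g 1 s + g 2 y)) has_real_derivative deriv G v * deriv (g 1) x) (at x)"
      using DERIV_chain2[where g = "\<lambda>s. g 1 s + g 2 y" and x = x, OF dG[unfolded v_def]
          DERIV_add[OF dg[of 1 x] DERIV_const[of "g 2 y"]]] x unfolding v_def by simp
    have "((\<lambda>s. (s + y) / 2) has_real_derivative 1 / 2) (at x)"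
      by (auto intro!: derivative_eq_intros)
    from DERIV_chain2[OF dF[unfolded u_def] this]
    have "((\<lambda>s. F ((s + y) / 2) + f 1 s + f 2 y) has_real_derivative
        deriv F u * (1 / 2) + deriv (f 1) x + 0) (at x)"
      unfolding u_def by (intro DERIV_add DERIV_const df) (use x in auto)
    then show "((\<lambda>s. G (g 1 s + g 2 y)) has_real_derivative
        deriv F u * (1 / 2) + deriv (f 1) x) (at x)"
      using has_field_derivative_transform_within_open[OF _ I(1) x] eq y by simp
  qed
  have 2: "deriv F u * (1 / 2) + deriv (f 2) y = deriv G v * deriv (g 2) y"
  proof (rule DERIV_unique)
    show "((\<lambda>t. G (g 1 x + g 2 t)) has_real_derivative deriv G v * deriv (g 2) y) (at y)"
      using DERIV_chain2[where g = "\<lambda>t. g 1 x + g 2 t" and x = y, OF dG[unfolded v_def]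
          DERIV_add[OF DERIV_const[of "g 1 x"] dg[of 2 y]]] y unfolding v_def by simp
    have "((\<lambda>t. (x + t) / 2) has_real_derivative 1 / 2) (at y)"
      by (auto intro!: derivative_eq_intros)
    from DERIV_chain2[OF dF[unfolded u_def] this]
    have "((\<lambda>t. F ((x + t) / 2) + f 1 x + f 2 t) has_real_derivative
        deriv F u * (1 / 2) + 0 + deriv (f 2) y) (at y)"
      unfolding u_def by (intro DERIV_add DERIV_const df) (use y in auto)
    then show "((\<lambda>t. G (g 1 x + g 2 t)) has_real_derivative
        deriv F u * (1 / 2) + deriv (f 2) y) (at y)"
      using has_field_derivative_transform_within_open[OF _ I(1) y] eq x by simp
  qed
  have "(deriv F u / 2 + deriv (f 1) x) / deriv (g 1) x
      = (deriv F u / 2 + deriv (f 2) y) / deriv (g 2) y"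
    using 1 2 nz by simp
  then show ?thesis
    unfolding phi_def u_def[symmetric] by (simp add: algebra_simps add_divide_distrib)
qed

text \<open>The mixed second difference kills \<open>U\<close> and \<open>V\<close> and leaves
  \<open>(y - u) (M x - M u) + (x - u) (W y - W u) = 0\<close>, so that both \<open>M\<close> and \<open>W\<close> are affine, with
  opposite slopes.\<close>

lemma separated_equation:
  fixes U V M W :: "real \<Rightarrow> real"
  assumes eq: "\<And>x y. x \<in> I \<Longrightarrow> y \<in> I \<Longrightarrow> y * M x + x * W y = U x + V y"
    and u: "u \<in> I" and v: "v \<in> I" and uv: "u \<noteq> v"
  obtains k e e' where "\<And>x. x \<in> I \<Longrightarrow> M x = k * x + e" and "\<And>x. x \<in> I \<Longrightarrow> W x = - k * x + e'"
proof -
  have mixed: "(y - u) * (M x - M u) + (x - u) * (W y - W u) = 0" if "x \<in> I" "y \<in> I" for x y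
    using eq[OF that] eq[OF that(1) u] eq[OF u that(2)] eq[OF u u]
    by (simp add: algebra_simps)
  define k where "k = - (W v - W u) / (v - u)"
  have vu: "v - u \<noteq> 0" using uv by simp
  have M: "M x - M u = k * (x - u)" if x: "x \<in> I" for x
    using mixed[OF x v] vu unfolding k_def by (simp add: field_simps)
  have "W y - W u = - k * (y - u)" if y: "y \<in> I" for y
  proof -
    have "(v - u) * (W y - W u + k * (y - u)) = 0"
      using mixed[OF v y] unfolding M[OF v] by (simp add: algebra_simps)
    then show ?thesis using vu by simp
  qed
  with M show ?thesis
    by (intro that[of k "M u - k * u" "W u + k * u"]) (simp_all add: algebra_simps)
qed

lemma constant_of_separated:
  assumes "\<And>x y. x \<in> I \<Longrightarrow> y \<in> I \<Longrightarrow> U x = V y" and "I \<noteq> {}"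
  obtains c where "\<And>x. x \<in> I \<Longrightarrow> U x = c" and "\<And>x. x \<in> I \<Longrightarrow> V x = c"
  using assms by (metis ex_in_conv)

text \<open>With \<open>X = x + \<beta>\<close> and \<open>Y = y + \<beta>\<close>, clearing the denominator gives
  \<open>2A (p x - q y) = (X + Y) (R x + S y)\<close> for \<open>R = r - B p\<close> and \<open>S = s + B q\<close>. Here
  \<open>Y R x + X S y\<close> is a sum of a function of \<open>x\<close> and one of \<open>y\<close>; hence \<open>R\<close> and \<open>S\<close> are affine and the
  right-hand side is a difference of quadratic polynomials.\<close>

lemma pole_coefficients:
  fixes p q r s :: "real \<Rightarrow> real"
  assumes A: "A \<noteq> 0" and u: "u \<in> I" and v: "v \<in> I" and uv: "u \<noteq> v"
    and nz: "\<And>x y. x \<in> I \<Longrightarrow> y \<in> I \<Longrightarrow> (x + \<beta>) + (y + \<beta>) \<noteq> 0"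
    and eq: "\<And>x y. x \<in> I \<Longrightarrow> y \<in> I \<Longrightarrow>
      (B + 2 * A / ((x + \<beta>) + (y + \<beta>))) * (p x - q y) = r x + s y"
  obtains \<kappa> E h N where
    "\<And>x. x \<in> I \<Longrightarrow> p x = \<kappa> * (x + \<beta>)\<^sup>2 + E * (x + \<beta>) + h"
    "\<And>x. x \<in> I \<Longrightarrow> q x = \<kappa> * (x + \<beta>)\<^sup>2 - E * (x + \<beta>) + h"
    "\<And>x. x \<in> I \<Longrightarrow> r x = B * p x + A * (2 * \<kappa> * (x + \<beta>) + E) - N"
    "\<And>x. x \<in> I \<Longrightarrow> s x = - B * q x - A * (2 * \<kappa> * (x + \<beta>) - E) + N"
proof -
  define R S where "R = (\<lambda>x. r x - B * p x)" and "S = (\<lambda>x. s x + B * q x)"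
  have RS: "2 * A * (p x - q y) = ((x + \<beta>) + (y + \<beta>)) * (R x + S y)" if "x \<in> I" "y \<in> I" for x y
  proof -
    define T where "T = (x + \<beta>) + (y + \<beta>)"
    have "T \<noteq> 0" unfolding T_def by (rule nz[OF that])
    moreover have "(B + 2 * A / T) * (p x - q y) = r x + s y"
      unfolding T_def by (rule eq[OF that])
    ultimately have "2 * A * (p x - q y) = T * (r x + s y - B * (p x - q y))"
      by (simp add: field_simps)
    also have "\<dots> = T * (R x + S y)" unfolding R_def S_def by (simp add: algebra_simps)
    finally show ?thesis unfolding T_def .
  qed
  have "y * R x + x * S y = (2 * A * p x - (x + 2 * \<beta>) * R x) + (- 2 * A * q y - (y + 2 * \<beta>) * S y)"
    if "x \<in> I" "y \<in> I" for x y
    using RS[OF that] by (simp add: algebra_simps)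
  from separated_equation[of I R S "\<lambda>x. 2 * A * p x - (x + 2 * \<beta>) * R x"
      "\<lambda>y. - 2 * A * q y - (y + 2 * \<beta>) * S y", OF this u v uv]
  obtain k e e' where ke: "\<And>x. x \<in> I \<Longrightarrow> R x = k * x + e" "\<And>x. x \<in> I \<Longrightarrow> S x = - k * x + e'"
    by blast
  define \<kappa> e1 e2 where "\<kappa> = k / (2 * A)" and "e1 = (e - k * \<beta>) / (2 * A)" and "e2 = (e' + k * \<beta>) / (2 * A)"
  define E where "E = e1 + e2"
  have R: "R x = 2 * A * (\<kappa> * (x + \<beta>) + e1)" if "x \<in> I" for x
    unfolding ke(1)[OF that] \<kappa>_def e1_def using A by (simp add: field_simps)
  have S: "S x = 2 * A * (- \<kappa> * (x + \<beta>) + e2)" if "x \<in> I" for x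
    unfolding ke(2)[OF that] \<kappa>_def e2_def using A by (simp add: field_simps)
  have "p x - \<kappa> * (x + \<beta>)\<^sup>2 - E * (x + \<beta>) = q y - \<kappa> * (y + \<beta>)\<^sup>2 + E * (y + \<beta>)"
    if "x \<in> I" "y \<in> I" for x y
  proof -
    have "2 * A * (p x - q y) =
      2 * A * (((x + \<beta>) + (y + \<beta>)) * (\<kappa> * (x + \<beta>) + e1 + (- \<kappa> * (y + \<beta>) + e2)))"
      unfolding RS[OF that] R[OF that(1)] S[OF that(2)] by (simp only: algebra_simps)
    then have "p x - q y = ((x + \<beta>) + (y + \<beta>)) * (\<kappa> * (x + \<beta>) + e1 + (- \<kappa> * (y + \<beta>) + e2))"
      using A by simp
    then show ?thesis unfolding E_def by (simp add: algebra_simps power2_eq_square)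
  qed
  then obtain h where h: "\<And>x. x \<in> I \<Longrightarrow> p x - \<kappa> * (x + \<beta>)\<^sup>2 - E * (x + \<beta>) = h"
    "\<And>x. x \<in> I \<Longrightarrow> q x - \<kappa> * (x + \<beta>)\<^sup>2 + E * (x + \<beta>) = h"
    using constant_of_separated[of I "\<lambda>x. p x - \<kappa> * (x + \<beta>)\<^sup>2 - E * (x + \<beta>)"
        "\<lambda>y. q y - \<kappa> * (y + \<beta>)\<^sup>2 + E * (y + \<beta>)"] u by blast
  show ?thesis
  proof (rule that[of \<kappa> E h "A * (e2 - e1)"])
    fix x assume x: "x \<in> I"
    show "p x = \<kappa> * (x + \<beta>)\<^sup>2 + E * (x + \<beta>) + h" using h(1)[OF x] by simp
    show "q x = \<kappa> * (x + \<beta>)\<^sup>2 - E * (x + \<beta>) + h" using h(2)[OF x] by simp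
    show "r x = B * p x + A * (2 * \<kappa> * (x + \<beta>) + E) - A * (e2 - e1)"
      using R[OF x] unfolding R_def E_def by (simp add: algebra_simps)
    show "s x = - B * q x - A * (2 * \<kappa> * (x + \<beta>) - E) + A * (e2 - e1)"
      using S[OF x] unfolding S_def E_def by (simp add: algebra_simps)
  qed
qed

lemma affine_coefficients:
  fixes p q r s :: "real \<Rightarrow> real"
  assumes c: "c \<noteq> 0" and u: "u \<in> I" and v: "v \<in> I" and uv: "u \<noteq> v"
    and eq: "\<And>x y. x \<in> I \<Longrightarrow> y \<in> I \<Longrightarrow> (c * ((x + y) / 2) + d) * (p x - q y) = r x + s y"
  obtains \<kappa> e e' where "\<And>x. x \<in> I \<Longrightarrow> p x = \<kappa> * x + e" and "\<And>x. x \<in> I \<Longrightarrow> q x = \<kappa> * x + e'"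
proof -
  have "y * (c / 2 * p x) + x * (- (c / 2) * q y) =
      (r x - (c / 2 * x + d) * p x) + (s y + (c / 2 * y + d) * q y)" if "x \<in> I" "y \<in> I" for x y
    using eq[OF that] by (simp add: field_simps)
  from separated_equation[of I "\<lambda>x. c / 2 * p x" "\<lambda>y. - (c / 2) * q y"
      "\<lambda>x. r x - (c / 2 * x + d) * p x" "\<lambda>y. s y + (c / 2 * y + d) * q y", OF this u v uv]
  obtain k e e' where ke: "\<And>x. x \<in> I \<Longrightarrow> c / 2 * p x = k * x + e"
    "\<And>x. x \<in> I \<Longrightarrow> - (c / 2) * q x = - k * x + e'"
    by blast
  show ?thesis
  proof (rule that[of "2 * k / c" "2 * e / c" "- 2 * e' / c"])
    fix x assume x: "x \<in> I"
    show "p x = 2 * k / c * x + 2 * e / c"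
      using ke(1)[OF x] c by (simp add: field_simps)
    show "q x = 2 * k / c * x + - 2 * e' / c"
      using ke(2)[OF x] c by (simp add: field_simps)
  qed
qed

text \<open>If \<open>g\<^sub>1\<close> and \<open>g\<^sub>2\<close> are affine with the same slope and \<open>f\<^sub>1 = f\<^sub>2 = 0\<close>, then the
  equation has a solution \<open>G\<close> for every \<open>F\<close>. The two structural conditions exclude this: in the first one
  \<open>\<psi>\<^sub>1\<close> has no zero, and in the second one \<open>\<psi>\<^sub>2\<close> has the derivative \<open>a S + b C\<close> up to a nonzero
  factor, which has no zero either.\<close>

lemma equal_constant_slopes_contradiction:
  assumes I: "open I" "I \<noteq> {}" and cond: "cond_4_2 I F g \<or> cond_5_2 I F f g"
    and h: "\<And>x. x \<in> I \<Longrightarrow> 1 / deriv (g 1) x = h" "\<And>x. x \<in> I \<Longrightarrow> 1 / deriv (g 2) x = h"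
  shows False
proof -
  obtain x where x: "x \<in> I" using I(2) by blast
  from cond show False
  proof
    assume "cond_4_2 I F g"
    then have "psi g 1 x \<noteq> 0" using x unfolding cond_4_2_def by blast
    then show False using h[OF x] unfolding psi_def by simp
  next
    assume "cond_5_2 I F f g"
    then obtain a b \<gamma> l where *: "\<And>t. t \<in> I \<Longrightarrow> a * S_fun \<gamma> t + b * C_fun \<gamma> t \<noteq> 0"
      "\<And>t. t \<in> I \<Longrightarrow> psi g 2 t = a * P_fun \<gamma> t + b * Q_fun \<gamma> t + l"
      unfolding cond_5_2_def by blast
    define w where "w = (if \<gamma> = 0 then 1 else sqrt \<bar>\<gamma>\<bar>)"
    have w: "w \<noteq> 0" unfolding w_def by auto
    have dP: "(P_fun \<gamma> has_real_derivative w * S_fun \<gamma> x) (at x)"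
      unfolding P_fun_def S_fun_def w_def by (auto intro!: derivative_eq_intros)
    have dQ: "(Q_fun \<gamma> has_real_derivative w * C_fun \<gamma> x) (at x)"
      unfolding Q_fun_def C_fun_def w_def by (auto intro!: derivative_eq_intros)
    have "((\<lambda>t. a * P_fun \<gamma> t + b * Q_fun \<gamma> t + l) has_real_derivative
        a * (w * S_fun \<gamma> x) + b * (w * C_fun \<gamma> x) + 0) (at x)"
      by (intro DERIV_add DERIV_cmult DERIV_const dP dQ)
    moreover have "((\<lambda>t. a * P_fun \<gamma> t + b * Q_fun \<gamma> t + l) has_real_derivative 0) (at x)"
    proof (rule has_field_derivative_transform_within_open[OF DERIV_const[of "2 * h"] I(1) x])
      fix t assume t: "t \<in> I"
      show "2 * h = a * P_fun \<gamma> t + b * Q_fun \<gamma> t + l"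
        using *(2)[OF t] h[OF t] unfolding psi_def by simp
    qed
    ultimately have "a * (w * S_fun \<gamma> x) + b * (w * C_fun \<gamma> x) + 0 = 0"
      by (rule DERIV_unique)
    then have "w * (a * S_fun \<gamma> x + b * C_fun \<gamma> x) = 0"
      by (simp add: algebra_simps)
    then show False using w *(1)[OF x] by simp
  qed
qed

section \<open>Integration\<close>

lemma eq_antiderivative_family:
  fixes h H :: "nat \<Rightarrow> real \<Rightarrow> real"
  assumes "is_interval I"
    and "\<And>k x. k \<in> K \<Longrightarrow> x \<in> I \<Longrightarrow> (h k has_real_derivative h' k x) (at x)"
    and "\<And>k x. k \<in> K \<Longrightarrow> x \<in> I \<Longrightarrow> (H k has_real_derivative h' k x) (at x)"
  obtains c where "\<And>k x. k \<in> K \<Longrightarrow> x \<in> I \<Longrightarrow> h k x = H k x + c k"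
proof -
  have "\<forall>k\<in>K. \<exists>c. \<forall>x\<in>I. h k x = H k x + c"
    using eq_antiderivative[OF assms(1), of "h k" "h' k" "H k" for k] assms(2,3) by metis
  from bchoice[OF this] obtain c where "\<forall>k\<in>K. \<forall>x\<in>I. h k x = H k x + c k" ..
  then show ?thesis using that by blast
qed

lemma F_logI:
  assumes "\<alpha> \<noteq> 0" and "\<beta> = 2 * \<alpha> * \<beta>'" and "\<And>x. x \<in> I \<Longrightarrow> x + \<beta>' \<noteq> 0"
    and "\<And>x. x \<in> I \<Longrightarrow> F x = 2 * A * ln \<bar>x + \<beta>'\<bar> + 2 * B * x + c"
  shows "F_log I F A B \<alpha> \<beta> (c - 2 * A * ln \<bar>2 * \<alpha>\<bar>)"
  unfolding F_log_def
proof
  fix x assume x: "x \<in> I"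
  have e: "2 * \<alpha> * x + \<beta> = 2 * \<alpha> * (x + \<beta>')"
    using assms(2) by (simp add: algebra_simps)
  have "ln \<bar>2 * \<alpha> * x + \<beta>\<bar> = ln \<bar>2 * \<alpha>\<bar> + ln \<bar>x + \<beta>'\<bar>"
    unfolding e abs_mult[of "2 * \<alpha>"] using assms(1) assms(3)[OF x] by (subst ln_mult) auto
  moreover have "2 * \<alpha> * x + \<beta> \<noteq> 0"
    unfolding e using assms(1) assms(3)[OF x] by simp
  ultimately show "2 * \<alpha> * x + \<beta> \<noteq> 0 \<and>
      F x = 2 * A * ln \<bar>2 * \<alpha> * x + \<beta>\<bar> + 2 * B * x + (c - 2 * A * ln \<bar>2 * \<alpha>\<bar>)"
    using assms(4)[OF x] by (simp add: algebra_simps)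
qed

text \<open>The two polynomials \<open>P 1\<close> and \<open>P 2\<close> have the same discriminant. If they are quadratic, its sign
  decides between \<open>arctan\<close>, a reciprocal and the logarithm of a fraction as antiderivatives of
  \<open>1 / P k\<close>; if they are linear, \<open>g\<^sub>1\<close> and \<open>g\<^sub>2\<close> are logarithms with opposite signs.\<close>

lemma log_solution_cases:
  fixes P :: "nat \<Rightarrow> real \<Rightarrow> real"
  assumes I: "I \<noteq> {}" "is_interval I" and sol: "solves I F f G g" and A: "A \<noteq> 0"
    and \<beta>: "\<And>x. x \<in> I \<Longrightarrow> x + \<beta>' \<noteq> 0"
    and F: "\<And>x. x \<in> I \<Longrightarrow> F x = 2 * A * ln \<bar>x + \<beta>'\<bar> + 2 * B * x + c"
    and P: "\<And>k x. P k x = \<kappa> * (x + \<beta>')\<^sup>2 + (-1) ^ (k - 1) * E * (x + \<beta>') + h"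
    and P0: "\<And>k x. k \<in> {1, 2} \<Longrightarrow> x \<in> I \<Longrightarrow> P k x \<noteq> 0"
    and g: "\<And>k x. k \<in> {1, 2} \<Longrightarrow> x \<in> I \<Longrightarrow> (g k has_real_derivative 1 / P k x) (at x)"
    and f: "\<And>k x. k \<in> {1, 2} \<Longrightarrow> x \<in> I \<Longrightarrow>
      f k x = - A * ln \<bar>P k x\<bar> - B * x + N * g k x + n k"
    and nconst: "\<kappa> \<noteq> 0 \<or> E \<noteq> 0"
  shows "\<exists>B C D \<alpha> \<beta> l0 b l m. admissible_constants A D \<alpha> \<beta> b \<and> F_log I F A B \<alpha> \<beta> l0 \<and>
            (P1_1 I f G g A B C D \<alpha> b l0 l m \<or> P1_2 I f G g A B C D \<alpha> b l0 l m \<or>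
             P1_3 I f G g A B C D \<alpha> b l0 l m \<or> P1_4 I f G g A B D \<alpha> b l0 l m)"
proof (cases "\<kappa> = 0")
  case False
  \<comment> \<open>completing the square: \<open>P k x = \<kappa> ((x + c' k)\<^sup>2 + \<delta>)\<close>\<close>
  define \<delta> where "\<delta> = h / \<kappa> - E\<^sup>2 / (4 * \<kappa>\<^sup>2)"
  define c' where "c' = (\<lambda>k. \<beta>' + (-1) ^ (k - 1) * E / (2 * \<kappa>))" for k :: nat
  have c12: "c' 1 + c' 2 = 2 * \<beta>'" unfolding c'_def by simp
  have Pk: "P k x = \<kappa> * ((x + c' k)\<^sup>2 + \<delta>)" if "k \<in> {1, 2}" for k x
    using that False unfolding P c'_def \<delta>_def by (auto simp: field_simps power2_eq_square)
  consider (pos) "\<delta> > 0" | (zero) "\<delta> = 0" | (neg) "\<delta> < 0" by linarith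
  then show ?thesis
  proof cases
    case pos
    define \<omega> where "\<omega> = sqrt \<delta>"
    have \<omega>: "\<omega> > 0" "\<omega>\<^sup>2 = \<delta>" using pos unfolding \<omega>_def by auto
    define \<alpha> b D where "\<alpha> = 1 / \<omega>" and "b = (\<lambda>k. c' k / \<omega>)" and "D = 1 / (\<kappa> * \<omega>)"
    have z: "\<alpha> * x + b k = (x + c' k) / \<omega>" for k x
      unfolding \<alpha>_def b_def by (simp add: add_divide_distrib)
    have Pz: "P k x = (\<kappa> * \<omega>\<^sup>2) * ((\<alpha> * x + b k)\<^sup>2 + 1)" if "k \<in> {1, 2}" for k x
      unfolding Pk[OF that] z using \<omega> pos by (simp add: power_divide field_simps)
    have adm: "admissible_constants A D \<alpha> (2 * \<alpha> * \<beta>') b"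
      unfolding admissible_constants_def \<alpha>_def b_def D_def using A False \<omega> c12
      by (simp add: add_divide_distrib[symmetric])
    have FL: "F_log I F A B \<alpha> (2 * \<alpha> * \<beta>') (c - 2 * A * ln \<bar>2 * \<alpha>\<bar>)"
      by (rule F_logI[OF _ refl \<beta> F]) (use \<omega> in \<open>simp_all add: \<alpha>_def\<close>)
    have pos: "0 < 1 + z\<^sup>2" for z :: real
      using zero_le_power2[of z] by linarith
    have "((\<lambda>x. D * arctan (\<alpha> * x + b k)) has_real_derivative 1 / P k x) (at x)"
      if "k \<in> {1, 2}" "x \<in> I" for k x
    proof -
      have "((\<lambda>x. D * arctan (\<alpha> * x + b k)) has_real_derivative
          D * (\<alpha> / (1 + (\<alpha> * x + b k)\<^sup>2))) (at x)"
        using pos by (auto intro!: derivative_eq_intros simp: divide_inverse)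
      moreover have "D * (\<alpha> / (1 + (\<alpha> * x + b k)\<^sup>2)) = 1 / P k x"
        unfolding Pz[OF that(1)] unfolding D_def \<alpha>_def using \<omega>(1) False
        by (simp add: power2_eq_square add.commute)
      ultimately show ?thesis by simp
    qed
    from eq_antiderivative_family[of I "{1, 2}" g, OF I(2) g this]
    obtain m where m: "\<And>k x. k \<in> {1, 2} \<Longrightarrow> x \<in> I \<Longrightarrow> g k x = D * arctan (\<alpha> * x + b k) + m k"
      by blast
    define l where "l = (\<lambda>k. n k + N * m k - A * ln \<bar>\<kappa> * \<omega>\<^sup>2\<bar>)"
    have fam: "\<forall>k\<in>{1,2}. \<forall>x\<in>I.
         f k x = - A * ln \<bar>(\<alpha> * x + b k)\<^sup>2 + 1\<bar> - B * x + (N * D) * arctan (\<alpha> * x + b k) + l k \<and>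
         g k x = D * arctan (\<alpha> * x + b k) + m k"
    proof (intro ballI conjI m)
      fix k :: nat and x assume k: "k \<in> {1, 2}" and x: "x \<in> I"
      have "ln \<bar>P k x\<bar> = ln \<bar>\<kappa> * \<omega>\<^sup>2\<bar> + ln \<bar>(\<alpha> * x + b k)\<^sup>2 + 1\<bar>"
        using P0[OF k x] unfolding Pz[OF k] abs_mult[of "\<kappa> * \<omega>\<^sup>2"] by (subst ln_mult) auto
      then show "f k x = - A * ln \<bar>(\<alpha> * x + b k)\<^sup>2 + 1\<bar> - B * x + (N * D) * arctan (\<alpha> * x + b k) + l k"
        unfolding f[OF k x] m[OF k x] l_def by (simp add: algebra_simps)
    qed
    have D0: "D \<noteq> 0" and b12: "b 1 + b 2 = 2 * \<alpha> * \<beta>'"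
      using adm unfolding admissible_constants_def by auto
    have "P1_1 I f G g A B (N * D) D \<alpha> b (c - 2 * A * ln \<bar>2 * \<alpha>\<bar>) l m"
      by (rule P1_1_solves_iff[OF I(2) FL b12 D0 fam, THEN iffD1, OF sol])
    with adm FL show ?thesis by blast
  next
    case zero
    \<comment> \<open>here, and in the linear case, \<open>\<alpha> = 1\<close>; the factor \<open>1\<close> is kept to match the families\<close>
    define b D where "b = c'" and "D = - (1 / \<kappa>)"
    have Pz: "P k x = \<kappa> * (1 * x + b k)\<^sup>2" if "k \<in> {1, 2}" for k x
      unfolding Pk[OF that] zero b_def by simp
    have z0: "1 * x + b k \<noteq> 0" if "k \<in> {1, 2}" "x \<in> I" for k x
      using P0[OF that] Pz[OF that(1), of x] by auto
    have adm: "admissible_constants A D 1 (2 * 1 * \<beta>') b"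
      unfolding admissible_constants_def b_def D_def using A False c12 by simp
    have FL: "F_log I F A B 1 (2 * 1 * \<beta>') (c - 2 * A * ln \<bar>2 * 1\<bar>)"
      by (rule F_logI[OF _ refl \<beta> F]) simp_all
    have "((\<lambda>x. D * inverse (1 * x + b k)) has_real_derivative 1 / P k x) (at x)"
      if "k \<in> {1, 2}" "x \<in> I" for k x
    proof -
      have "((\<lambda>x. D * inverse (1 * x + b k)) has_real_derivative
          D * - (inverse (1 * x + b k) * 1 * inverse (1 * x + b k))) (at x)"
        using z0[OF that] by (auto intro!: derivative_eq_intros)
      moreover have "D * - (inverse (1 * x + b k) * 1 * inverse (1 * x + b k)) = 1 / P k x"
        unfolding Pz[OF that(1)] D_def using False z0[OF that]
        by (simp add: power2_eq_square divide_simps)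
      ultimately show ?thesis by simp
    qed
    from eq_antiderivative_family[of I "{1, 2}" g, OF I(2) g this]
    obtain m where m: "\<And>k x. k \<in> {1, 2} \<Longrightarrow> x \<in> I \<Longrightarrow> g k x = D * inverse (1 * x + b k) + m k"
      by blast
    define l where "l = (\<lambda>k. n k + N * m k - A * ln \<bar>\<kappa>\<bar>)"
    have fam: "\<forall>k\<in>{1,2}. \<forall>x\<in>I. 1 * x + b k \<noteq> 0 \<and>
         f k x = - 2 * A * ln \<bar>1 * x + b k\<bar> - B * x + (N * D) * inverse (1 * x + b k) + l k \<and>
         g k x = D * inverse (1 * x + b k) + m k"
    proof (intro ballI conjI m z0)
      fix k :: nat and x assume k: "k \<in> {1, 2}" and x: "x \<in> I"
      have "\<bar>P k x\<bar> = \<bar>\<kappa>\<bar> * \<bar>1 * x + b k\<bar>\<^sup>2"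
        unfolding Pz[OF k] by (simp only: abs_mult power_abs)
      moreover have "ln (\<bar>1 * x + b k\<bar>\<^sup>2) = 2 * ln \<bar>1 * x + b k\<bar>"
        by (subst ln_realpow) (use z0[OF k x] in auto)
      ultimately have "ln \<bar>P k x\<bar> = ln \<bar>\<kappa>\<bar> + 2 * ln \<bar>1 * x + b k\<bar>"
        using ln_mult_pos[of "\<bar>\<kappa>\<bar>" "\<bar>1 * x + b k\<bar>\<^sup>2"] False z0[OF k x] by simp
      then show "f k x = - 2 * A * ln \<bar>1 * x + b k\<bar> - B * x + (N * D) * inverse (1 * x + b k) + l k"
        unfolding f[OF k x] m[OF k x] l_def by (simp add: algebra_simps)
    qed
    have D0: "D \<noteq> 0" and b12: "b 1 + b 2 = 2 * 1 * \<beta>'"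
      using adm unfolding admissible_constants_def by auto
    have "P1_2 I f G g A B (N * D) D 1 b (c - 2 * A * ln \<bar>2 * 1\<bar>) l m"
      by (rule P1_2_solves_iff[OF I(2) FL b12 D0 fam, THEN iffD1, OF sol])
    with adm FL show ?thesis by blast
  next
    case neg
    define \<omega> where "\<omega> = sqrt (- \<delta>)"
    have \<omega>: "\<omega> > 0" "\<omega>\<^sup>2 = - \<delta>" using neg unfolding \<omega>_def by auto
    define \<alpha> b D where "\<alpha> = 1 / \<omega>" and "b = (\<lambda>k. c' k / \<omega>)" and "D = 1 / (2 * \<kappa> * \<omega>)"
    have z: "\<alpha> * x + b k = (x + c' k) / \<omega>" for k x
      unfolding \<alpha>_def b_def by (simp add: add_divide_distrib)
    have Pz: "P k x = (\<kappa> * \<omega>\<^sup>2) * ((\<alpha> * x + b k)\<^sup>2 - 1)" if "k \<in> {1, 2}" for k x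
      unfolding Pk[OF that] z using \<omega> neg by (simp add: power_divide field_simps)
    have z0: "(\<alpha> * x + b k)\<^sup>2 - 1 \<noteq> 0" if "k \<in> {1, 2}" "x \<in> I" for k x
      using P0[OF that] Pz[OF that(1), of x] by auto
    have adm: "admissible_constants A D \<alpha> (2 * \<alpha> * \<beta>') b"
      unfolding admissible_constants_def \<alpha>_def b_def D_def using A False \<omega> c12
      by (simp add: add_divide_distrib[symmetric])
    have FL: "F_log I F A B \<alpha> (2 * \<alpha> * \<beta>') (c - 2 * A * ln \<bar>2 * \<alpha>\<bar>)"
      by (rule F_logI[OF _ refl \<beta> F]) (use \<omega> in \<open>simp_all add: \<alpha>_def\<close>)
    have "((\<lambda>x. D * (ln \<bar>(\<alpha> * x + b k - 1) / (\<alpha> * x + b k + 1)\<bar>)) has_real_derivative 1 / P k x) (at x)"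
      if "k \<in> {1, 2}" "x \<in> I" for k x
    proof -
      have "D * (2 * \<alpha> / ((\<alpha> * x + b k)\<^sup>2 - 1)) = 1 / P k x"
        unfolding Pz[OF that(1)] unfolding D_def \<alpha>_def using \<omega>(1) False
        by (simp add: power2_eq_square)
      with DERIV_cmult[OF has_real_derivative_ln_fraction[OF z0[OF that]], of D]
      show ?thesis by simp
    qed
    from eq_antiderivative_family[of I "{1, 2}" g, OF I(2) g this]
    obtain m where m: "\<And>k x. k \<in> {1, 2} \<Longrightarrow> x \<in> I \<Longrightarrow>
        g k x = D * (ln \<bar>(\<alpha> * x + b k - 1) / (\<alpha> * x + b k + 1)\<bar>) + m k"
      by blast
    define l where "l = (\<lambda>k. n k + N * m k - A * ln \<bar>\<kappa> * \<omega>\<^sup>2\<bar>)"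
    have fam: "\<forall>k\<in>{1,2}. \<forall>x\<in>I. (\<alpha> * x + b k)\<^sup>2 - 1 \<noteq> 0 \<and>
         f k x = - A * ln \<bar>(\<alpha> * x + b k)\<^sup>2 - 1\<bar> - B * x
                 + (N * D) * (ln \<bar>(\<alpha> * x + b k - 1) / (\<alpha> * x + b k + 1)\<bar>) + l k \<and>
         g k x = D * (ln \<bar>(\<alpha> * x + b k - 1) / (\<alpha> * x + b k + 1)\<bar>) + m k"
    proof (intro ballI conjI m z0)
      fix k :: nat and x assume k: "k \<in> {1, 2}" and x: "x \<in> I"
      have "ln \<bar>P k x\<bar> = ln \<bar>\<kappa> * \<omega>\<^sup>2\<bar> + ln \<bar>(\<alpha> * x + b k)\<^sup>2 - 1\<bar>"
        using P0[OF k x] unfolding Pz[OF k] abs_mult[of "\<kappa> * \<omega>\<^sup>2"] by (subst ln_mult) auto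
      then show "f k x = - A * ln \<bar>(\<alpha> * x + b k)\<^sup>2 - 1\<bar> - B * x
                 + (N * D) * (ln \<bar>(\<alpha> * x + b k - 1) / (\<alpha> * x + b k + 1)\<bar>) + l k"
        unfolding f[OF k x] m[OF k x] l_def by (simp add: algebra_simps)
    qed
    have D0: "D \<noteq> 0" and b12: "b 1 + b 2 = 2 * \<alpha> * \<beta>'"
      using adm unfolding admissible_constants_def by auto
    have "P1_3 I f G g A B (N * D) D \<alpha> b (c - 2 * A * ln \<bar>2 * \<alpha>\<bar>) l m"
      by (rule P1_3_solves_iff[OF I FL b12 D0 fam, THEN iffD1, OF sol])
    with adm FL show ?thesis by blast
  qed
next
  case True
  with nconst have E: "E \<noteq> 0" by simp
  define b D where "b = (\<lambda>k. \<beta>' + (-1) ^ (k - 1) * h / E)" and "D = 1 / E" for k :: nat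
  have Pz: "P k x = (-1) ^ (k - 1) * E * (1 * x + b k)" if "k \<in> {1, 2}" for k x
    using that E unfolding P True b_def by (auto simp: field_simps)
  have z0: "1 * x + b k \<noteq> 0" if "k \<in> {1, 2}" "x \<in> I" for k x
    using P0[OF that] Pz[OF that(1), of x] by auto
  have adm: "admissible_constants A D 1 (2 * 1 * \<beta>') b"
    unfolding admissible_constants_def b_def D_def using A E by simp
  have FL: "F_log I F A B 1 (2 * 1 * \<beta>') (c - 2 * A * ln \<bar>2 * 1\<bar>)"
    by (rule F_logI[OF _ refl \<beta> F]) simp_all
  have "((\<lambda>x. (-1) ^ (k - 1) * D * (ln \<bar>1 * x + b k\<bar>)) has_real_derivative 1 / P k x) (at x)"
    if "k \<in> {1, 2}" "x \<in> I" for k x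
  proof -
    have "((\<lambda>x. 1 * x + b k) has_real_derivative 1) (at x)"
      by (auto intro!: derivative_eq_intros)
    from DERIV_cmult[OF has_real_derivative_ln_abs[OF this z0[OF that]], of "(-1) ^ (k - 1) * D"]
    show ?thesis
      unfolding Pz[OF that(1)] D_def using that(1) E by auto
  qed
  from eq_antiderivative_family[of I "{1, 2}" g, OF I(2) g this]
  obtain m where m: "\<And>k x. k \<in> {1, 2} \<Longrightarrow> x \<in> I \<Longrightarrow>
      g k x = (-1) ^ (k - 1) * D * (ln \<bar>1 * x + b k\<bar>) + m k"
    by blast
  define l where "l = (\<lambda>k. n k + N * m k - A * ln \<bar>E\<bar>)"
  define A' where "A' = (\<lambda>k. A - (-1) ^ (k - 1) * N * D)" for k :: nat
  have A': "(A' 1 + A' 2) / 2 = A" unfolding A'_def by simp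
  have fam: "\<forall>k\<in>{1,2}. \<forall>x\<in>I. 1 * x + b k \<noteq> 0 \<and>
         f k x = - A' k * (ln \<bar>1 * x + b k\<bar>) - B * x + l k \<and>
         g k x = (-1) ^ (k - 1) * D * (ln \<bar>1 * x + b k\<bar>) + m k"
  proof (intro ballI conjI m z0)
    fix k :: nat and x assume k: "k \<in> {1, 2}" and x: "x \<in> I"
    have "ln \<bar>P k x\<bar> = ln \<bar>E\<bar> + ln \<bar>1 * x + b k\<bar>"
      using E z0[OF k x] unfolding Pz[OF k] abs_mult[of _ "1 * x + b k"]
      by (subst ln_mult) (auto simp: abs_mult power_abs)
    then show "f k x = - A' k * (ln \<bar>1 * x + b k\<bar>) - B * x + l k"
      unfolding f[OF k x] m[OF k x] l_def A'_def by (simp add: algebra_simps)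
  qed
  have "D \<noteq> 0" "b 1 + b 2 = 2 * 1 * \<beta>'" using adm unfolding admissible_constants_def by auto
  from P1_4_solves_iff[OF I FL this(2,1) A' fam, THEN iffD1, OF sol]
  have "P1_4 I f G g A B D 1 b (c - 2 * A * ln \<bar>2 * 1\<bar>) l m"
    unfolding P1_4_def Let_def by (intro exI[where x = A'] conjI A' fam)
  with adm FL show ?thesis by blast
qed

text \<open>If \<open>\<phi>\<close> is affine, then \<open>1/g\<^sub>1'\<close> and \<open>1/g\<^sub>2'\<close> are affine with a common slope \<open>\<kappa>\<close>. For
  \<open>\<kappa> \<noteq> 0\<close> the functions \<open>g\<^sub>k\<close> are logarithms, for \<open>\<kappa> = 0\<close> they are affine.\<close>

lemma quadratic_solution_cases:
  assumes I: "I \<noteq> {}" "is_interval I" and sol: "solves I F f G g" and c: "c \<noteq> 0"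
    and u: "u \<in> I" and v: "v \<in> I" and uv: "u \<noteq> v"
    and F: "\<And>x. x \<in> I \<Longrightarrow> (F has_real_derivative 2 * (c * x + d)) (at x)"
    and pq0: "\<And>x. x \<in> I \<Longrightarrow> p x \<noteq> 0" "\<And>x. x \<in> I \<Longrightarrow> q x \<noteq> 0"
    and eq: "\<And>x y. x \<in> I \<Longrightarrow> y \<in> I \<Longrightarrow> (c * ((x + y) / 2) + d) * (p x - q y) = r x + s y"
    and g: "\<And>x. x \<in> I \<Longrightarrow> (g 1 has_real_derivative 1 / p x) (at x)"
      "\<And>x. x \<in> I \<Longrightarrow> (g 2 has_real_derivative 1 / q x) (at x)"
    and f: "\<And>x. x \<in> I \<Longrightarrow> (f 1 has_real_derivative - r x / p x) (at x)"
      "\<And>x. x \<in> I \<Longrightarrow> (f 2 has_real_derivative s x / q x) (at x)"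
  shows "\<exists>A B C D \<alpha> \<beta> l0 b l m. admissible_constants A D \<alpha> \<beta> b \<and>
      (P2_1 I F f G g A B C l0 l m \<or> P2_2 I F f G g A B C D \<beta> b l0 l m)"
proof -
  obtain \<kappa> e e' where pq: "\<And>x. x \<in> I \<Longrightarrow> p x = \<kappa> * x + e" "\<And>x. x \<in> I \<Longrightarrow> q x = \<kappa> * x + e'"
    using affine_coefficients[OF c u v uv eq] by blast
  show ?thesis
  proof (cases "\<kappa> = 0")
    case False
    define b where "b = (\<lambda>k::nat. if k = 1 then e / \<kappa> else e' / \<kappa>)"
    \<comment> \<open>\<open>A\<close> and \<open>B\<close> are chosen such that \<open>c t + d = 2A(2t + \<beta>) + B\<close>\<close>
    define A B \<beta> D where "A = c / 4" and "B = d - c * (b 1 + b 2) / 2" and "\<beta> = b 1 + b 2"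
      and "D = 1 / \<kappa>"
    have p: "p x = \<kappa> * (x + b 1)" if "x \<in> I" for x
      unfolding pq(1)[OF that] b_def using False by (simp add: field_simps)
    have q: "q x = \<kappa> * (x + b 2)" if "x \<in> I" for x
      unfolding pq(2)[OF that] b_def using False by (simp add: field_simps)
    have z0: "x + b k \<noteq> 0" if "k \<in> {1, 2}" "x \<in> I" for k x
      using that pq0[OF that(2)] p[OF that(2)] q[OF that(2)] by auto
    \<comment> \<open>\<open>\<phi>\<close> at the midpoint is \<open>2A(z + w) + B\<close> and \<open>p x - q y = \<kappa>(z - w)\<close>, where \<open>z = x + b 1\<close> and \<open>w = y + b 2\<close>\<close>
    have "r x - (2 * A * (x + b 1) + B) * (\<kappa> * (x + b 1)) =
        - s y - (2 * A * (y + b 2) + B) * (\<kappa> * (y + b 2))" if "x \<in> I" "y \<in> I" for x y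
    proof -
      have "c * ((x + y) / 2) + d = 2 * A * ((x + b 1) + (y + b 2)) + B"
        unfolding A_def B_def by (simp add: field_simps)
      then have "(2 * A * ((x + b 1) + (y + b 2)) + B) * (\<kappa> * (x + b 1) - \<kappa> * (y + b 2)) = r x + s y"
        using eq[OF that] unfolding p[OF that(1)] q[OF that(2)] by simp
      then show ?thesis by (simp add: algebra_simps)
    qed
    from constant_of_separated[of I "\<lambda>x. r x - (2 * A * (x + b 1) + B) * (\<kappa> * (x + b 1))"
        "\<lambda>y. - s y - (2 * A * (y + b 2) + B) * (\<kappa> * (y + b 2))", OF this I(1)]
    obtain \<rho> where \<rho>: "\<And>x. x \<in> I \<Longrightarrow> r x - (2 * A * (x + b 1) + B) * (\<kappa> * (x + b 1)) = \<rho>"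
      "\<And>x. x \<in> I \<Longrightarrow> - s x - (2 * A * (x + b 2) + B) * (\<kappa> * (x + b 2)) = \<rho>"
      by blast
    have rs: "r x = (2 * A * (x + b 1) + B) * (\<kappa> * (x + b 1)) + \<rho>"
      "s x = - (2 * A * (x + b 2) + B) * (\<kappa> * (x + b 2)) - \<rho>" if "x \<in> I" for x
      using \<rho>[OF that] by (simp_all add: algebra_simps)
    define C where "C = - (\<rho> / \<kappa>)"
    have g': "(g k has_real_derivative D * (1 / (x + b k))) (at x)" if "k \<in> {1, 2}" "x \<in> I" for k x
      using that g[OF that(2)] unfolding p[OF that(2)] q[OF that(2)] D_def by auto
    have f1: "- r x / p x = - A * (2 * (x + b 1)) - B + C * (1 / (x + b 1))" if "x \<in> I" for x
      unfolding p[OF that] rs[OF that] C_def using z0[of 1 x] that False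
      by (simp add: divide_simps) (simp add: algebra_simps)
    have f2: "s x / q x = - A * (2 * (x + b 2)) - B + C * (1 / (x + b 2))" if "x \<in> I" for x
      unfolding q[OF that] rs[OF that] C_def using z0[of 2 x] that False
      by (simp add: divide_simps)
    have f': "(f k has_real_derivative - A * (2 * (x + b k)) - B + C * (1 / (x + b k))) (at x)"
      if "k \<in> {1, 2}" "x \<in> I" for k x
      using that f[OF that(2)] unfolding f1[OF that(2)] f2[OF that(2)] by auto
    have dL: "((\<lambda>x. ln \<bar>x + b k\<bar>) has_real_derivative 1 / (x + b k)) (at x)"
      if "k \<in> {1, 2}" "x \<in> I" for k x
      using z0[OF that] by (auto intro!: derivative_eq_intros)
    have "((\<lambda>x. D * (ln \<bar>x + b k\<bar>)) has_real_derivative D * (1 / (x + b k))) (at x)"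
      if "k \<in> {1, 2}" "x \<in> I" for k x
      by (rule DERIV_cmult[OF dL[OF that]])
    from eq_antiderivative_family[of I "{1, 2}" g, OF I(2) g' this]
    obtain m where m: "\<And>k x. k \<in> {1, 2} \<Longrightarrow> x \<in> I \<Longrightarrow> g k x = D * (ln \<bar>x + b k\<bar>) + m k"
      by blast
    have "((\<lambda>x. - A * (x + b k)\<^sup>2 - B * x + C * (ln \<bar>x + b k\<bar>)) has_real_derivative
        - A * (2 * (x + b k)) - B + C * (1 / (x + b k))) (at x)"
      if "k \<in> {1, 2}" "x \<in> I" for k x
    proof (intro DERIV_add DERIV_diff DERIV_cmult dL that)
      show "((\<lambda>x. (x + b k)\<^sup>2) has_real_derivative 2 * (x + b k)) (at x)"
        by (auto intro!: derivative_eq_intros)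
      show "((*) B has_real_derivative B) (at x)"
        by (auto intro!: derivative_eq_intros)
    qed
    from eq_antiderivative_family[of I "{1, 2}" f, OF I(2) f' this]
    obtain l where l: "\<And>k x. k \<in> {1, 2} \<Longrightarrow> x \<in> I \<Longrightarrow>
        f k x = - A * (x + b k)\<^sup>2 - B * x + C * (ln \<bar>x + b k\<bar>) + l k"
      by blast
    have "((\<lambda>x. A * (2 * x + \<beta>)\<^sup>2 + 2 * B * x) has_real_derivative 2 * (c * x + d)) (at x)" for x
      unfolding A_def B_def \<beta>_def by (auto intro!: derivative_eq_intros simp: field_simps)
    from eq_antiderivative[OF I(2) F this]
    obtain l0 where l0: "\<And>x. x \<in> I \<Longrightarrow> F x = A * (2 * x + \<beta>)\<^sup>2 + 2 * B * x + l0"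
      by blast
    have D0: "D \<noteq> 0" unfolding D_def using False by simp
    have "P2_2 I F f G g A B C D \<beta> b l0 l m"
      by (rule P2_2_solves_iff[OF I \<beta>_def[symmetric] D0, THEN iffD1, OF _ _ sol])
        (intro ballI conjI l0 l m z0, assumption+)+
    moreover have "admissible_constants A D 1 \<beta> b"
      unfolding admissible_constants_def \<beta>_def A_def using D0 c by simp
    ultimately show ?thesis by blast
  next
    case True
    then have pq: "p x = e" "q x = e'" if "x \<in> I" for x
      using pq[OF that] by auto
    have e0: "e \<noteq> 0" "e' \<noteq> 0" using pq0[OF u] pq[OF u] by auto
    have "r x - c / 2 * (e - e') * x = - s y + c / 2 * (e - e') * y + d * (e - e')"
      if "x \<in> I" "y \<in> I" for x y
      using eq[OF that] unfolding pq(1)[OF that(1)] pq(2)[OF that(2)] by (simp add: field_simps)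
    from constant_of_separated[of I "\<lambda>x. r x - c / 2 * (e - e') * x"
        "\<lambda>y. - s y + c / 2 * (e - e') * y + d * (e - e')", OF this I(1)]
    obtain \<rho> where \<rho>: "\<And>x. x \<in> I \<Longrightarrow> r x - c / 2 * (e - e') * x = \<rho>"
      "\<And>x. x \<in> I \<Longrightarrow> - s x + c / 2 * (e - e') * x + d * (e - e') = \<rho>"
      by blast
    define D' A' B' C where "D' = (\<lambda>k::nat. if k = 1 then 1 / e else 1 / e')"
      and "A' = (\<lambda>k::nat. if k = 1 then - (c * (e - e') / (4 * e)) else c * (e - e') / (4 * e'))"
      and "B' = (\<lambda>k::nat. if k = 1 then - (\<rho> / e) else (d * (e - e') - \<rho>) / e')"
      and "C = d * e - \<rho>"
    have DD: "D' 1 * D' 2 \<noteq> 0" unfolding D'_def using e0 by simp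
    have rel: "\<forall>k\<in>{1,2}. D' 1 * D' 2 * (c + 4 * A' k) = (D' k)\<^sup>2 * c \<and> 2 * d + 2 * B' k = 2 * D' k * C"
      unfolding D'_def A'_def B'_def C_def using e0 by (auto simp: field_simps power2_eq_square)
    have r: "r x = c / 2 * (e - e') * x + \<rho>" and s: "s x = c / 2 * (e - e') * x + (d * (e - e') - \<rho>)"
      if "x \<in> I" for x
      using \<rho>[OF that] by simp_all
    have g': "(g k has_real_derivative D' k) (at x)" if "k \<in> {1, 2}" "x \<in> I" for k x
      using that g[OF that(2)] unfolding pq[OF that(2)] D'_def by auto
    have f1: "- r x / p x = A' 1 * (2 * x) + B' 1" if "x \<in> I" for x
      unfolding pq[OF that] r[OF that] A'_def B'_def using e0 by (simp add: field_simps)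
    have f2: "s x / q x = A' 2 * (2 * x) + B' 2" if "x \<in> I" for x
      unfolding pq[OF that] s[OF that] A'_def B'_def using e0 by (simp add: field_simps)
    have f': "(f k has_real_derivative A' k * (2 * x) + B' k) (at x)"
      if "k \<in> {1, 2}" "x \<in> I" for k x
      using that f[OF that(2)] unfolding f1[OF that(2)] f2[OF that(2)] by auto
    have "((\<lambda>x. D' k * x) has_real_derivative D' k) (at x)" for k x
      by (auto intro!: derivative_eq_intros)
    from eq_antiderivative_family[of I "{1, 2}" g, OF I(2) g' this]
    obtain m where m: "\<And>k x. k \<in> {1, 2} \<Longrightarrow> x \<in> I \<Longrightarrow> g k x = D' k * x + m k"
      by blast
    have "((\<lambda>x. A' k * x\<^sup>2 + B' k * x) has_real_derivative A' k * (2 * x) + B' k) (at x)" for k x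
      by (auto intro!: derivative_eq_intros)
    from eq_antiderivative_family[of I "{1, 2}" f, OF I(2) f' this]
    obtain l where l: "\<And>k x. k \<in> {1, 2} \<Longrightarrow> x \<in> I \<Longrightarrow> f k x = A' k * x\<^sup>2 + B' k * x + l k"
      by blast
    have "((\<lambda>x. c * x\<^sup>2 + 2 * d * x) has_real_derivative 2 * (c * x + d)) (at x)" for x
      by (auto intro!: derivative_eq_intros simp: algebra_simps)
    from eq_antiderivative[OF I(2) F this]
    obtain l0 where l0: "\<And>x. x \<in> I \<Longrightarrow> F x = c * x\<^sup>2 + 2 * d * x + l0"
      by blast
    have Fq: "\<forall>x\<in>I. F x = c * x\<^sup>2 + 2 * d * x + l0"
      and fg: "\<forall>k\<in>{1,2}. \<forall>x\<in>I. f k x = A' k * x\<^sup>2 + B' k * x + l k \<and> g k x = D' k * x + m k"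
      using l0 l m by blast+
    have "P2_1 I F f G g c (2 * d) C l0 l m"
      unfolding P2_1_def Let_def
      by (intro exI[where x = A'] exI[where x = B'] exI[where x = D'] conjI DD rel Fq fg
          P2_1_solves_iff[OF DD rel I(2) Fq fg, THEN iffD1, OF sol])
    \<comment> \<open>\<open>D, \<alpha>, \<beta>, b\<close> do not occur in this family\<close>
    moreover have "admissible_constants c 1 1 0 (\<lambda>k. 0)"
      unfolding admissible_constants_def using c by simp
    ultimately show ?thesis by blast
  qed
qed

section \<open>Classification\<close>

lemma regular_solution_classification:
  assumes I: "I \<noteq> {}" "open I" "is_interval I" and sol: "regular_solution I F f G g"
    and cond: "cond_4_2 I F g \<or> cond_5_2 I F f g" and lin: "linear_fraction_on I (phi F)"
  shows "\<exists>A B C D \<alpha> \<beta> l0 b l m. admissible_constants A D \<alpha> \<beta> b \<and>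
          ((F_log I F A B \<alpha> \<beta> l0 \<and>
              (P1_1 I f G g A B C D \<alpha> b l0 l m \<or> P1_2 I f G g A B C D \<alpha> b l0 l m \<or>
               P1_3 I f G g A B C D \<alpha> b l0 l m \<or> P1_4 I f G g A B D \<alpha> b l0 l m)) \<or>
           (P2_1 I F f G g A B C l0 l m \<or> P2_2 I F f G g A B C D \<beta> b l0 l m))"
proof -
  have reg: "regular I F f G g" and sol': "solves I F f G g"
    using sol unfolding regular_solution_def by auto
  have dF: "(F has_real_derivative 2 * phi F x) (at x)" if "x \<in> I" for x
    using C1_differentiable_on_DERIV[OF _ that] reg unfolding regular_def phi_def by simp
  have df: "(f k has_real_derivative deriv (f k) x) (at x)"
    and dg: "(g k has_real_derivative deriv (g k) x) (at x)" if "k \<in> {1, 2}" "x \<in> I" for k x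
    using C1_differentiable_on_DERIV[OF _ that(2)] reg that unfolding regular_def by blast+
  have g0: "deriv (g k) x \<noteq> 0" if "k \<in> {1, 2}" "x \<in> I" for k x
    using reg that unfolding regular_def by auto
  define p q r s where "p = (\<lambda>x. 1 / deriv (g 1) x)" and "q = (\<lambda>x. 1 / deriv (g 2) x)"
    and "r = (\<lambda>x. - (deriv (f 1) x / deriv (g 1) x))" and "s = (\<lambda>x. deriv (f 2) x / deriv (g 2) x)"
  have pq0: "p x \<noteq> 0" "q x \<noteq> 0" if "x \<in> I" for x
    unfolding p_def q_def using g0[OF _ that] by auto
  have g: "(g 1 has_real_derivative 1 / p x) (at x)" "(g 2 has_real_derivative 1 / q x) (at x)"
    if "x \<in> I" for x
    unfolding p_def q_def using dg[OF _ that] by auto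
  have f: "(f 1 has_real_derivative - r x / p x) (at x)" "(f 2 has_real_derivative s x / q x) (at x)"
    if "x \<in> I" for x
    unfolding p_def q_def r_def s_def using df[OF _ that] g0[OF _ that] by auto
  have eq: "phi F ((x + y) / 2) * (p x - q y) = r x + s y" if "x \<in> I" "y \<in> I" for x y
    unfolding p_def q_def r_def s_def
    by (rule regular_solution_derivative_equation[OF I(2,3) sol that])
  obtain u where u: "u \<in> I" using I(1) by blast
  obtain \<epsilon> where \<epsilon>: "\<epsilon> > 0" "ball u \<epsilon> \<subseteq> I" using I(2) u by (auto simp: open_contains_ball)
  have v: "u + \<epsilon> / 2 \<in> I" using \<epsilon> by (intro subsetD[OF \<epsilon>(2)]) (auto simp: dist_real_def)
  have uv: "u \<noteq> u + \<epsilon> / 2" using \<epsilon>(1) by simp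
  obtain a b c d where abcd: "a * d \<noteq> b * c"
    and ab: "\<And>x. x \<in> I \<Longrightarrow> a * x + b \<noteq> 0" "\<And>x. x \<in> I \<Longrightarrow> phi F x = (c * x + d) / (a * x + b)"
    using lin unfolding linear_fraction_on_def by blast
  show ?thesis
  proof (cases "a = 0")
    case True
    then have b0: "b \<noteq> 0" "c / b \<noteq> 0" using abcd by auto
    have ph: "phi F x = c / b * x + d / b" if "x \<in> I" for x
      using ab(2)[OF that] True by (simp add: add_divide_distrib)
    have dF': "(F has_real_derivative 2 * (c / b * x + d / b)) (at x)" if "x \<in> I" for x
      using dF[OF that] unfolding ph[OF that] .
    have "(c / b * ((x + y) / 2) + d / b) * (p x - q y) = r x + s y" if "x \<in> I" "y \<in> I" for x y
      using eq[OF that] unfolding ph[OF midpoint_mem_interval[OF I(3) that]] .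
    from quadratic_solution_cases[OF I(1,3) sol' b0(2) u v uv dF' pq0 this g f]
    show ?thesis by blast
  next
    case False
    \<comment> \<open>partial fractions: \<open>\<phi> = B + A / (x + \<beta>)\<close>\<close>
    define \<beta> A B where "\<beta> = b / a" and "A = (a * d - b * c) / a\<^sup>2" and "B = c / a"
    have A0: "A \<noteq> 0" unfolding A_def using abcd False by simp
    have T0: "x + \<beta> \<noteq> 0" if "x \<in> I" for x
      using ab(1)[OF that] False unfolding \<beta>_def by (auto simp: field_simps)
    have ph: "phi F x = B + A / (x + \<beta>)" if "x \<in> I" for x
    proof -
      have e: "a * x + b = a * (x + \<beta>)" unfolding \<beta>_def using False by (simp add: field_simps)
      have "c * x + d = c * (x + \<beta>) + a * A"
        unfolding \<beta>_def A_def using False by (simp add: field_simps power2_eq_square)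
      then show ?thesis
        unfolding ab(2)[OF that] e B_def using False T0[OF that] by (simp add: add_divide_distrib)
    qed
    have mid: "(x + y) / 2 + \<beta> = ((x + \<beta>) + (y + \<beta>)) / 2" for x y
      by (simp add: field_simps)
    have nz: "(x + \<beta>) + (y + \<beta>) \<noteq> 0" if "x \<in> I" "y \<in> I" for x y
      using T0[OF midpoint_mem_interval[OF I(3) that]] unfolding mid by simp
    have "(B + 2 * A / ((x + \<beta>) + (y + \<beta>))) * (p x - q y) = r x + s y" if "x \<in> I" "y \<in> I" for x y
      using eq[OF that] unfolding ph[OF midpoint_mem_interval[OF I(3) that]] mid
      by (simp add: mult.commute)
    from pole_coefficients[OF A0 u v uv nz this]
    obtain \<kappa> E h N where p: "\<And>x. x \<in> I \<Longrightarrow> p x = \<kappa> * (x + \<beta>)\<^sup>2 + E * (x + \<beta>) + h"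
      and q: "\<And>x. x \<in> I \<Longrightarrow> q x = \<kappa> * (x + \<beta>)\<^sup>2 - E * (x + \<beta>) + h"
      and r: "\<And>x. x \<in> I \<Longrightarrow> r x = B * p x + A * (2 * \<kappa> * (x + \<beta>) + E) - N"
      and s: "\<And>x. x \<in> I \<Longrightarrow> s x = - B * q x - A * (2 * \<kappa> * (x + \<beta>) - E) + N"
      by blast
    have "\<kappa> \<noteq> 0 \<or> E \<noteq> 0"
    proof (rule ccontr)
      assume "\<not> (\<kappa> \<noteq> 0 \<or> E \<noteq> 0)"
      then have "p x = h" "q x = h" if "x \<in> I" for x
        using p[OF that] q[OF that] by auto
      then show False
        using equal_constant_slopes_contradiction[OF I(2,1) cond, of h]
        unfolding p_def q_def by blast
    qed
    define P where "P = (\<lambda>(k::nat) x. \<kappa> * (x + \<beta>)\<^sup>2 + (-1) ^ (k - 1) * E * (x + \<beta>) + h)"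
    define P' where "P' = (\<lambda>(k::nat) x. 2 * \<kappa> * (x + \<beta>) + (-1) ^ (k - 1) * E)"
    have P12: "P 1 x = p x" "P 2 x = q x" if "x \<in> I" for x
      unfolding P_def p[OF that] q[OF that] by simp_all
    have P0: "P k x \<noteq> 0" if "k \<in> {1, 2}" "x \<in> I" for k x
      using that pq0[OF that(2)] P12[OF that(2)] by auto
    have g': "(g k has_real_derivative 1 / P k x) (at x)" if "k \<in> {1, 2}" "x \<in> I" for k x
      using that g[OF that(2)] P12[OF that(2)] by auto
    have dP: "(P k has_real_derivative P' k x) (at x)" for k x
      unfolding P_def P'_def by (auto intro!: derivative_eq_intros)
    have f': "(f k has_real_derivative - A * (P' k x / P k x) - B + N * (1 / P k x)) (at x)"
      if "k \<in> {1, 2}" "x \<in> I" for k x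
    proof -
      have "- r x / p x = - A * (P' 1 x / P 1 x) - B + N * (1 / P 1 x)"
        unfolding P12[OF that(2)] r[OF that(2)] P'_def using pq0[OF that(2)]
        by (simp add: field_simps)
      moreover have "s x / q x = - A * (P' 2 x / P 2 x) - B + N * (1 / P 2 x)"
        unfolding P12[OF that(2)] s[OF that(2)] P'_def using pq0[OF that(2)]
        by (simp add: field_simps)
      ultimately show ?thesis using that f[OF that(2)] by auto
    qed
    have "((\<lambda>x. - A * ln \<bar>P k x\<bar> - B * x + N * g k x) has_real_derivative
        - A * (P' k x / P k x) - B + N * (1 / P k x)) (at x)" if "k \<in> {1, 2}" "x \<in> I" for k x
    proof (intro DERIV_add DERIV_diff DERIV_cmult has_real_derivative_ln_abs dP P0 g' that)
      show "((*) B has_real_derivative B) (at x)"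
        by (auto intro!: derivative_eq_intros)
    qed
    from eq_antiderivative_family[of I "{1, 2}" f, OF I(3) f' this]
    obtain n where n: "\<And>k x. k \<in> {1, 2} \<Longrightarrow> x \<in> I \<Longrightarrow>
        f k x = - A * ln \<bar>P k x\<bar> - B * x + N * g k x + n k"
      by blast
    have "((\<lambda>x. 2 * A * ln \<bar>x + \<beta>\<bar> + 2 * B * x) has_real_derivative 2 * phi F x) (at x)"
      if "x \<in> I" for x
      unfolding ph[OF that] using T0[OF that] by (auto intro!: derivative_eq_intros simp: algebra_simps)
    from eq_antiderivative[OF I(3) dF this]
    obtain c' where c': "\<And>x. x \<in> I \<Longrightarrow> F x = 2 * A * ln \<bar>x + \<beta>\<bar> + 2 * B * x + c'"
      by blast
    have P: "P k x = \<kappa> * (x + \<beta>)\<^sup>2 + (-1) ^ (k - 1) * E * (x + \<beta>) + h" for k x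
      unfolding P_def ..
    from log_solution_cases[OF I(1,3) sol' A0 T0 c' P P0 g' n \<open>\<kappa> \<noteq> 0 \<or> E \<noteq> 0\<close>]
    show ?thesis by blast
  qed
qed

theorem theorem17:
  fixes I :: "real set"
    and F G :: "real \<Rightarrow> real"
    and f g :: "nat \<Rightarrow> real \<Rightarrow> real"
  assumes "I \<noteq> {}" and "open I" and "is_interval I"
  shows
    "(regular_solution I F f G g \<and> cond_B_2_2 I F f g \<longrightarrow>
       (\<exists>(A::real) (B::real) (C::real) (D::real) (\<alpha>::real) (\<beta>::real) (l0::real)
          (b::nat \<Rightarrow> real) (l::nat \<Rightarrow> real) (m::nat \<Rightarrow> real).
          admissible_constants A D \<alpha> \<beta> b \<and>
          ((F_log I F A B \<alpha> \<beta> l0 \<and>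
              (P1_1 I f G g A B C D \<alpha> b l0 l m \<or> P1_2 I f G g A B C D \<alpha> b l0 l m \<or>
               P1_3 I f G g A B C D \<alpha> b l0 l m \<or> P1_4 I f G g A B D \<alpha> b l0 l m)) \<or>
           (P2_1 I F f G g A B C l0 l m \<or> P2_2 I F f G g A B C D \<beta> b l0 l m)))) \<and>
     (\<forall>(A::real) (B::real) (C::real) (D::real) (\<alpha>::real) (\<beta>::real) (l0::real)
        (b::nat \<Rightarrow> real) (l::nat \<Rightarrow> real) (m::nat \<Rightarrow> real).
        admissible_constants A D \<alpha> \<beta> b \<and>
        ((F_log I F A B \<alpha> \<beta> l0 \<and>
            (P1_1 I f G g A B C D \<alpha> b l0 l m \<or> P1_2 I f G g A B C D \<alpha> b l0 l m \<or>
             P1_3 I f G g A B C D \<alpha> b l0 l m \<or> P1_4 I f G g A B D \<alpha> b l0 l m)) \<or>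
         (P2_1 I F f G g A B C l0 l m \<or> P2_2 I F f G g A B C D \<beta> b l0 l m))
        \<longrightarrow> regular_solution I F f G g)"
proof (intro conjI allI impI)
  assume "regular_solution I F f G g \<and> cond_B_2_2 I F f g"
  then show "\<exists>A B C D \<alpha> \<beta> l0 b l m. admissible_constants A D \<alpha> \<beta> b \<and>
          ((F_log I F A B \<alpha> \<beta> l0 \<and>
              (P1_1 I f G g A B C D \<alpha> b l0 l m \<or> P1_2 I f G g A B C D \<alpha> b l0 l m \<or>
               P1_3 I f G g A B C D \<alpha> b l0 l m \<or> P1_4 I f G g A B D \<alpha> b l0 l m)) \<or>
           (P2_1 I F f G g A B C l0 l m \<or> P2_2 I F f G g A B C D \<beta> b l0 l m))"
    unfolding cond_B_2_2_def
    by (elim conjE) (rule regular_solution_classification[OF assms])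
next
  fix A B C D \<alpha> \<beta> l0 :: real and b l m :: "nat \<Rightarrow> real"
  assume "admissible_constants A D \<alpha> \<beta> b \<and>
        ((F_log I F A B \<alpha> \<beta> l0 \<and>
            (P1_1 I f G g A B C D \<alpha> b l0 l m \<or> P1_2 I f G g A B C D \<alpha> b l0 l m \<or>
             P1_3 I f G g A B C D \<alpha> b l0 l m \<or> P1_4 I f G g A B D \<alpha> b l0 l m)) \<or>
         (P2_1 I F f G g A B C l0 l m \<or> P2_2 I F f G g A B C D \<beta> b l0 l m))"
  then show "regular_solution I F f G g"
    by (elim conjE) (rule solution_families_regular_solution[OF assms])
qed

end
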